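(* Let $A, B\subseteq \mathbb Z$ be nonempty. Then there is a $k\in \mathbb N$ (depending only on $A+B$) such that the following holds. If $\mathbf F=(F_{n})_{n\in \mathbb N}$ is a Følner sequence in $\mathbb Z$ satisfying \[\delta:= \underline{\mathrm{d}}_{\mathbf F}(A)+\underline{\mathrm{d}}_{\mathbf F}(B)-\underline{\mathrm{d}}_{\mathbf F}(A+B)>0,\] then there is a subsequence $(F_{n_{j}})_{j\in \mathbb N}$ and sets $\Psi_{j}\subseteq F_{n_{j}}$ such that $\mathbf\Psi=(\Psi_{j})_{j\in \mathbb N}$ is a Følner sequence satisfying \begin{enumerate} \item $\liminf_{j\to\infty} |\Psi_{j}|/|F_{n_{j}}|\geq k\delta$; \item $\mathrm{d}_{\mathbf \Psi}(A+B)=\mathrm{d}_{\mathbf \Psi}(A+B+k\mathbb Z)$; \item $\mathrm{d}_{\mathbf \Psi}(A)+\mathrm{d}_{\mathbf \Psi}(B)-\mathrm{d}_{\mathbf \Psi}(A+B)\geq \delta$. \end{enumerate}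
   Context: For $A,B\subseteq\mathbb Z$, $A+B:=\{a+b:a\in A,b\in B\}$. A Følner sequence in $\mathbb Z$ is a sequence $\mathbf F=(F_n)_{n\in\mathbb N}$ of finite nonempty subsets of $\mathbb Z$ with $\lim_{n\to\infty}|(F_n+t)\triangle F_n|/|F_n|=0$ for all $t\in\mathbb Z$. For $C\subseteq \mathbb Z$, $\underline{\mathrm{d}}_{\mathbf F}(C):=\liminf_{n\to\infty}|C\cap F_n|/|F_n|$, $\bar{\mathrm{d}}_{\mathbf F}(C):=\limsup_{n\to\infty}|C\cap F_n|/|F_n|$, and $\mathrm{d}_{\mathbf F}(C)$ denotes the limit $\lim_{n\to\infty}|C\cap F_n|/|F_n|$ when it exists. *)

theory Defs
  imports Complex_Main "HOL-Library.Extended_Real" "HOL-Library.Set_Algebras"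
begin

definition folner_seq :: "(nat \<Rightarrow> int set) \<Rightarrow> bool" where
  "folner_seq F \<longleftrightarrow>
     (\<forall>n. finite (F n) \<and> F n \<noteq> {}) \<and>
     (\<forall>t. (\<lambda>n. real (card (sym_diff ((\<lambda>x. x + t) ` F n) (F n))) / real (card (F n)))
           \<longlonglongrightarrow> 0)"

definition rel_density :: "(nat \<Rightarrow> int set) \<Rightarrow> int set \<Rightarrow> nat \<Rightarrow> real" where
  "rel_density F C n = real (card (C \<inter> F n)) / real (card (F n))"

text \<open>The lower limit is taken in the extended reals, as \<^const>\<open>liminf\<close> needs a complete lattice.
  Since relative densities lie between 0 and 1, converting back to \<^typ>\<open>real\<close> loses nothing;
  see \<open>ereal_lower_density\<close> below.\<close>

definition lower_density :: "(nat \<Rightarrow> int set) \<Rightarrow> int set \<Rightarrow> real" where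
  "lower_density F C = real_of_ereal (liminf (\<lambda>n. ereal (rel_density F C n)))"

text \<open>The value of \<open>folner_density\<close> is meaningful only under \<open>has_density\<close>.\<close>

definition has_density :: "(nat \<Rightarrow> int set) \<Rightarrow> int set \<Rightarrow> bool" where
  "has_density F C \<longleftrightarrow> convergent (rel_density F C)"

definition folner_density :: "(nat \<Rightarrow> int set) \<Rightarrow> int set \<Rightarrow> real" where
  "folner_density F C = lim (rel_density F C)"

definition multiples :: "nat \<Rightarrow> int set" where
  "multiples k = range (\<lambda>m. int k * m)"

lemma ereal_lower_density:
  assumes "folner_seq F"
  shows "ereal (lower_density F C) = liminf (\<lambda>n. ereal (rel_density F C n))"
proof -
  have b: "0 \<le> rel_density F C n \<and> rel_density F C n \<le> 1" for n
  proof -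
    have "finite (F n)" using assms by (simp add: folner_seq_def)
    hence "card (C \<inter> F n) \<le> card (F n)" by (intro card_mono) auto
    thus ?thesis by (auto simp: rel_density_def divide_le_eq)
  qed
  have "0 \<le> liminf (\<lambda>n. ereal (rel_density F C n))"
    by (rule Liminf_bounded) (use b in auto)
  moreover have "liminf (\<lambda>n. ereal (rel_density F C n)) \<le> liminf (\<lambda>n. 1)"
    by (rule Liminf_mono) (use b in auto)
  hence "liminf (\<lambda>n. ereal (rel_density F C n)) \<le> 1" by (simp add: Liminf_const)
  ultimately have "\<bar>liminf (\<lambda>n. ereal (rel_density F C n))\<bar> \<noteq> \<infinity>" by auto
  thus ?thesis by (simp add: lower_density_def ereal_real')
qed

end

theory Submission
  imports Defs "HOL-Analysis.Analysis"
begin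

text \<open>Densities along a subsequence of \<open>F\<close> are encoded by a positive shift-invariant functional \<open>\<nu>\<close> on
  bounded functions; call \<open>\<nu>(A) + \<nu>(B) - \<nu>(A + B)\<close> the deficiency of \<open>\<nu>\<close>. A functional of positive
  deficiency contains a piece all of whose pieces have deficiency at least \<open>d\<close> times their mass,
  and a Dyson transform argument shows that on such a piece \<open>A + B\<close> fills its residue classes
  modulo some \<open>N\<close> up to measure zero. The minimal period \<open>k\<close> so obtained depends on \<open>A + B\<close> only,
  because a nonempty periodic set has positive measure for every nonzero functional.

  Let \<open>\<omega>\<close> be the part of \<open>\<nu>\<close> living on longer and longer windows on which \<open>A + B\<close> and \<open>A + B + k\<int>\<close>
  agree. The rest \<open>\<nu> - \<omega>\<close> has no positive deficiency, since otherwise it would contain a further periodic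
  piece. So \<open>\<omega>\<close> has deficiency at least \<open>\<delta>\<close>, while Kneser's theorem modulo \<open>k\<close> bounds it by \<open>1 / k\<close>
  times the mass of \<open>\<omega>\<close>. The sets \<open>\<Psi>\<close> are the intersections of the \<open>F n\<close> with the windows.\<close>

section \<open>Generalized limits and invariant functionals\<close>

text \<open>Functionals replace densities because every bounded function has a value under them:
  extremal pieces exist by compactness, and pieces can be subtracted, rescaled and convolved. The
  price is that they are only finitely additive. Moreover a null set says nothing about any given
  stretch of integers. Here invariance helps: if D = (A + B + k\<int>) - (A + B) is null, so is
  every finite union of translates of D, hence almost all of the mass lies in D-free intervals of
  any prescribed length.

  A functional may contain many saturated pieces, found by different choices. That all of them have
  the same period is what allows one set of windows to capture every one of them. Removing the rest
  is harmless since deficiency is additive over pieces, and the mass of \<omega> is at most 1, so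
  normalizing \<omega> does not push its deficiency below \<delta>.\<close>

definition bfun :: "('a \<Rightarrow> real) \<Rightarrow> bool" where
  "bfun f \<longleftrightarrow> (\<exists>M. \<forall>x. \<bar>f x\<bar> \<le> M)"

lemma bfunI: "(\<And>x. \<bar>f x\<bar> \<le> M) \<Longrightarrow> bfun f"
  unfolding bfun_def by blast

lemma bfunE:
  assumes "bfun f"
  obtains M where "M \<ge> 0" "\<And>x. \<bar>f x\<bar> \<le> M"
  using assms unfolding bfun_def by (meson abs_ge_zero order_trans)

lemma bfun_const [simp]: "bfun (\<lambda>x. c)"
  by (rule bfunI[of _ "\<bar>c\<bar>"]) simp

lemma bfun_indicator [simp]: "bfun (indicator S)"
  by (rule bfunI[of _ 1]) (simp add: indicator_def)

lemma bfun_add [simp]: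
  assumes "bfun f" "bfun g" shows "bfun (\<lambda>x. f x + g x)"
proof -
  obtain M where M: "\<And>x. \<bar>f x\<bar> \<le> M" using assms(1) bfunE by blast
  obtain L where L: "\<And>x. \<bar>g x\<bar> \<le> L" using assms(2) bfunE by blast
  have "\<bar>f x + g x\<bar> \<le> M + L" for x using M[of x] L[of x] by linarith
  thus ?thesis by (rule bfunI)
qed

lemma bfun_mult [simp]:
  assumes "bfun f" "bfun g" shows "bfun (\<lambda>x. f x * g x)"
proof -
  obtain M where M: "M \<ge> 0" "\<And>x. \<bar>f x\<bar> \<le> M" using assms(1) bfunE by blast
  obtain L where L: "L \<ge> 0" "\<And>x. \<bar>g x\<bar> \<le> L" using assms(2) bfunE by blast
  have "\<bar>f x * g x\<bar> \<le> M * L" for x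
    unfolding abs_mult using M L by (intro mult_mono) auto
  thus ?thesis by (rule bfunI)
qed

lemma bfun_minus [simp]:
  assumes "bfun f" shows "bfun (\<lambda>x. - f x)"
  using assms unfolding bfun_def by simp

lemma bfun_diff [simp]:
  assumes "bfun f" "bfun g" shows "bfun (\<lambda>x. f x - g x)"
  using bfun_add[OF assms(1) bfun_minus[OF assms(2)]] by simp

lemma bfun_sum [simp]:
  assumes "\<And>i. i \<in> I \<Longrightarrow> bfun (f i)" shows "bfun (\<lambda>x. \<Sum>i\<in>I. f i x)"
  using assms by (induction I rule: infinite_finite_induct) auto

lemma bfun_comp:
  assumes "bfun f" shows "bfun (\<lambda>x. f (h x))"
  using assms unfolding bfun_def by blast

lemma bfun_shift: "bfun f \<Longrightarrow> bfun (\<lambda>x::int. f (x + t))"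
  by (rule bfun_comp)

lemma bfun_indicator_comp [simp]: "bfun (\<lambda>x. indicator S (h x))"
  by (rule bfun_comp) simp

text \<open>A cluster point, in the product topology, of the evaluations at \<open>0, 1, 2, \<dots>\<close>
  of bounded sequences.\<close>

lemma ex_cluster_functional:
  "\<exists>\<phi> :: (nat \<Rightarrow> real) \<Rightarrow> real. \<forall>S e m. finite S \<longrightarrow> (\<forall>f\<in>S. bfun f) \<longrightarrow> e > 0 \<longrightarrow>
     (\<exists>n\<ge>m. \<forall>f\<in>S. \<bar>f n - \<phi> f\<bar> < e)"
proof -
  \<comment> \<open>Unbounded sequences are evaluated to 0 and get the bound 0, so that every
    evaluation lies in the compact box \<open>K\<close> indexed by all sequences.\<close>
  define M where "M f = (if bfun f then SOME M. \<forall>n. \<bar>f n\<bar> \<le> M else 0)" for f :: "nat \<Rightarrow> real"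
  have M: "\<bar>f n\<bar> \<le> M f" if "bfun f" for f n
    using someI_ex[of "\<lambda>M. \<forall>n. \<bar>f n\<bar> \<le> M"] that unfolding M_def bfun_def by auto
  define x where "x n = (\<lambda>f. if bfun f then f n else 0)" for n :: nat
  define K where "K = PiE UNIV (\<lambda>f. {- M f .. M f})"
  have "compactin (product_topology (\<lambda>_. euclidean) UNIV) K"
    unfolding K_def by (subst compactin_PiE) auto
  hence "compact K" by (simp add: euclidean_product_topology)
  moreover have "eventually (\<lambda>y. y \<in> K) (filtermap x sequentially)"
  proof -
    have "x n \<in> K" for n
    proof -
      have "x n f \<in> {- M f .. M f}" for f
        using M[of f n] by (cases "bfun f") (auto simp: x_def M_def abs_le_iff)
      thus ?thesis unfolding K_def by auto
    qed
    thus ?thesis by (simp add: eventually_filtermap)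
  qed
  moreover have "filtermap x sequentially \<noteq> bot" by (simp add: filtermap_bot_iff)
  ultimately obtain l where l: "l \<in> K" "inf (nhds l) (filtermap x sequentially) \<noteq> bot"
    unfolding compact_filter by blast
  have "\<exists>n\<ge>m. \<forall>f\<in>S. \<bar>f n - l f\<bar> < e"
    if S: "finite S" "\<forall>f\<in>S. bfun f" and e: "e > 0" for S e m
  proof (rule ccontr)
    assume *: "\<not> (\<exists>n\<ge>m. \<forall>f\<in>S. \<bar>f n - l f\<bar> < e)"
    define U where "U = PiE UNIV (\<lambda>f. if f \<in> S then ball (l f) e else UNIV)"
    have "{i. (if i \<in> S then ball (l i) e else UNIV) \<noteq> UNIV} \<subseteq> S" by auto
    hence "finite {i. (if i \<in> S then ball (l i) e else UNIV) \<noteq> UNIV}"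
      using S(1) finite_subset by blast
    hence "open U" unfolding U_def by (intro open_PiE) auto
    moreover have "l \<in> U" unfolding U_def using e by auto
    ultimately have 1: "eventually (\<lambda>y. y \<in> U) (nhds l)"
      using eventually_nhds by blast
    have "x n \<notin> U" if nm: "n \<ge> m" for n
    proof -
      obtain f where f: "f \<in> S" "\<not> \<bar>f n - l f\<bar> < e" using * nm by blast
      have "x n f = f n" using S(2) f(1) unfolding x_def by metis
      hence "x n f \<notin> ball (l f) e"
        using f(2) by (simp add: dist_real_def abs_minus_commute)
      moreover have "x n f \<in> ball (l f) e" if "x n \<in> U"
        using PiE_mem[OF that[unfolded U_def], of f] f(1) by simp
      ultimately show ?thesis by blast
    qed
    hence 2: "eventually (\<lambda>y. y \<notin> U) (filtermap x sequentially)"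
      unfolding eventually_filtermap eventually_sequentially by blast
    have "eventually (\<lambda>y. False) (inf (nhds l) (filtermap x sequentially))"
      unfolding eventually_inf using 1 2 by blast
    thus False using l(2) by (simp add: eventually_False)
  qed
  thus ?thesis by blast
qed

definition glim :: "(nat \<Rightarrow> real) \<Rightarrow> real" where
  "glim = (SOME \<phi>. \<forall>S e m. finite S \<longrightarrow> (\<forall>f\<in>S. bfun f) \<longrightarrow> e > 0 \<longrightarrow>
     (\<exists>n\<ge>m. \<forall>f\<in>S. \<bar>f n - \<phi> f\<bar> < e))"

text \<open>The one property from which everything about \<open>glim\<close> is derived. An index
  serves finitely many sequences at once and can be taken arbitrarily late: the former gives
  linearity and monotonicity, the latter agreement with ordinary limits, and both together later
  select the indices of the extracted sequence.\<close>

lemma glim_approx: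
  assumes "finite S" "\<forall>f\<in>S. bfun f" "e > 0"
  shows "\<exists>n\<ge>m. \<forall>f\<in>S. \<bar>f n - glim f\<bar> < e"
  using someI_ex[OF ex_cluster_functional] assms unfolding glim_def[symmetric] by blast

text \<open>The form with a sum lets one epsilon argument cover both monotonicity, with
  \<open>g\<close> zero, and additivity, where the upper bound comes from moving \<open>f\<close> to
  the other side.\<close>

lemma glim_mono_add:
  assumes "bfun f" "bfun g" "bfun h" "\<And>n. n \<ge> m \<Longrightarrow> f n + g n \<le> h n"
  shows "glim f + glim g \<le> glim h"
proof (rule field_le_epsilon)
  fix e :: real assume e: "e > 0"
  obtain n where "n \<ge> m" "\<forall>k\<in>{f,g,h}. \<bar>k n - glim k\<bar> < e / 3"
    using glim_approx[of "{f,g,h}" "e/3" m] assms e by auto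
  hence "\<bar>f n - glim f\<bar> < e / 3" "\<bar>g n - glim g\<bar> < e / 3" "\<bar>h n - glim h\<bar> < e / 3" "n \<ge> m"
    by blast+
  with assms(4)[of n] show "glim f + glim g \<le> glim h + e" by linarith
qed

lemma glim_tendsto:
  assumes "f \<longlonglongrightarrow> l" shows "glim f = l"
proof -
  have b: "bfun f"
    using convergent_imp_Bseq[OF convergentI[OF assms]] unfolding Bseq_def bfun_def by auto
  have "\<bar>glim f - l\<bar> \<le> 0 + e" if e: "e > 0" for e
  proof -
    obtain m where m: "\<And>n. n \<ge> m \<Longrightarrow> \<bar>f n - l\<bar> < e / 2"
      using LIMSEQ_D[OF assms, of "e/2"] e by auto
    obtain n where "n \<ge> m" "\<bar>f n - glim f\<bar> < e / 2"
      using glim_approx[of "{f}" "e/2" m] b e by auto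
    with m[of n] show ?thesis by linarith
  qed
  hence "\<bar>glim f - l\<bar> \<le> 0" by (rule field_le_epsilon)
  thus ?thesis by simp
qed

lemma glim_const [simp]: "glim (\<lambda>n. c) = c"
  by (rule glim_tendsto) simp

lemma glim_mono:
  assumes "bfun f" "bfun g" "\<And>n. n \<ge> m \<Longrightarrow> f n \<le> g n"
  shows "glim f \<le> glim g"
  using glim_mono_add[of f "\<lambda>_. 0" g m] assms by simp

lemma glim_cong:
  assumes "bfun f" "bfun g" "\<And>n. n \<ge> m \<Longrightarrow> f n = g n"
  shows "glim f = glim g"
  using glim_mono[of f g m] glim_mono[of g f m] assms by force

lemma glim_cmult:
  assumes "bfun f" shows "glim (\<lambda>n. c * f n) = c * glim f"
proof -
  have "\<bar>glim (\<lambda>n. c * f n) - c * glim f\<bar> \<le> 0 + e" if e: "e > 0" for e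
  proof -
    define d where "d = min (e / 2) (e / 2 / (\<bar>c\<bar> + 1))"
    have d: "d > 0" using e by (simp add: d_def)
    obtain n where n: "\<bar>f n - glim f\<bar> < d" "\<bar>c * f n - glim (\<lambda>n. c * f n)\<bar> < d"
      using glim_approx[of "{f, \<lambda>n. c * f n}" d 0] assms d by auto
    have "\<bar>c * f n - c * glim f\<bar> = \<bar>c\<bar> * \<bar>f n - glim f\<bar>"
      by (simp add: abs_mult[symmetric] algebra_simps)
    also have "\<dots> \<le> (\<bar>c\<bar> + 1) * (e / 2 / (\<bar>c\<bar> + 1))"
      using n(1) by (intro mult_mono) (auto simp: d_def)
    also have "\<dots> = e / 2" using abs_ge_zero[of c] by (simp add: field_simps)
    finally have "\<bar>c * f n - c * glim f\<bar> \<le> e / 2" .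
    moreover have "d \<le> e / 2" unfolding d_def by (rule min.cobounded1)
    ultimately show ?thesis using n(2) by linarith
  qed
  hence "\<bar>glim (\<lambda>n. c * f n) - c * glim f\<bar> \<le> 0" by (rule field_le_epsilon)
  thus ?thesis by simp
qed

lemma glim_add:
  assumes "bfun f" "bfun g" shows "glim (\<lambda>n. f n + g n) = glim f + glim g"
proof (rule antisym)
  have "glim (\<lambda>n. f n + g n) + glim (\<lambda>n. (-1) * f n) \<le> glim g"
    using assms by (intro glim_mono_add[of _ _ _ 0]) auto
  thus "glim (\<lambda>n. f n + g n) \<le> glim f + glim g"
    using glim_cmult[OF assms(1), of "-1"] by simp
  show "glim f + glim g \<le> glim (\<lambda>n. f n + g n)"
    using assms by (intro glim_mono_add[of _ _ _ 0]) auto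
qed

text \<open>Invariant finitely additive measures on the integers, viewed as integrals; the total
  mass is free and may be 0. The type makes \<open>\<nu>\<close> total, so its values at unbounded
  functions are left unconstrained.\<close>

definition imeas :: "((int \<Rightarrow> real) \<Rightarrow> real) \<Rightarrow> bool" where
  "imeas \<nu> \<longleftrightarrow>
     (\<forall>f g. bfun f \<longrightarrow> bfun g \<longrightarrow> \<nu> (\<lambda>x. f x + g x) = \<nu> f + \<nu> g) \<and>
     (\<forall>c f. bfun f \<longrightarrow> \<nu> (\<lambda>x. c * f x) = c * \<nu> f) \<and>
     (\<forall>f. bfun f \<longrightarrow> (\<forall>x. 0 \<le> f x) \<longrightarrow> 0 \<le> \<nu> f) \<and>
     (\<forall>f t. bfun f \<longrightarrow> \<nu> (\<lambda>x. f (x + t)) = \<nu> f)"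

abbreviation msr :: "((int \<Rightarrow> real) \<Rightarrow> real) \<Rightarrow> int set \<Rightarrow> real" where
  "msr \<nu> S \<equiv> \<nu> (indicator S)"

abbreviation mass :: "((int \<Rightarrow> real) \<Rightarrow> real) \<Rightarrow> real" where
  "mass \<nu> \<equiv> \<nu> (\<lambda>x. 1)"

context
  fixes \<nu> assumes \<nu>: "imeas \<nu>"
begin

lemma imeas_add: "bfun f \<Longrightarrow> bfun g \<Longrightarrow> \<nu> (\<lambda>x. f x + g x) = \<nu> f + \<nu> g"
  using \<nu> by (simp add: imeas_def)

lemma imeas_cmult: "bfun f \<Longrightarrow> \<nu> (\<lambda>x. c * f x) = c * \<nu> f"
  using \<nu> by (simp add: imeas_def)

lemma imeas_nonneg: "bfun f \<Longrightarrow> (\<And>x. 0 \<le> f x) \<Longrightarrow> 0 \<le> \<nu> f"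
  using \<nu> by (simp add: imeas_def)

lemma imeas_shift: "bfun f \<Longrightarrow> \<nu> (\<lambda>x. f (x + t)) = \<nu> f"
  using \<nu> by (simp add: imeas_def)

lemma imeas_const: "\<nu> (\<lambda>x. c) = c * mass \<nu>"
  using imeas_cmult[of "\<lambda>_. 1" c] by simp

lemma imeas_zero [simp]: "\<nu> (\<lambda>x. 0) = 0"
  using imeas_cmult[of "\<lambda>_. 1" 0] by simp

lemma imeas_diff: "bfun f \<Longrightarrow> bfun g \<Longrightarrow> \<nu> (\<lambda>x. f x - g x) = \<nu> f - \<nu> g"
  using imeas_add[of f "\<lambda>x. (-1) * g x"] imeas_cmult[of g "-1"] by simp

lemma imeas_mono:
  assumes "bfun f" "bfun g" "\<And>x. f x \<le> g x"
  shows "\<nu> f \<le> \<nu> g"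
  using imeas_nonneg[of "\<lambda>x. g x - f x", OF bfun_diff[OF assms(2,1)]] imeas_diff[OF assms(2,1)]
    assms(3) by simp

lemma imeas_sum:
  assumes "\<And>i. i \<in> I \<Longrightarrow> bfun (f i)"
  shows "\<nu> (\<lambda>x. \<Sum>i\<in>I. f i x) = (\<Sum>i\<in>I. \<nu> (f i))"
  using assms
  by (induction I rule: infinite_finite_induct) (simp_all add: imeas_add)

lemma imeas_abs_le:
  assumes "\<And>x. \<bar>f x\<bar> \<le> M"
  shows "\<bar>\<nu> f\<bar> \<le> M * mass \<nu>"
proof -
  have b: "bfun f" using assms by (rule bfunI)
  have "\<nu> f \<le> \<nu> (\<lambda>x. M)" "\<nu> (\<lambda>x. - M) \<le> \<nu> f"
    using assms b by (auto intro!: imeas_mono simp: abs_le_iff minus_le_iff)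
  thus ?thesis by (simp add: imeas_const[of M] imeas_const[of "-M"] abs_le_iff)
qed

lemma msr_nonneg: "0 \<le> msr \<nu> S"
  by (rule imeas_nonneg) auto

lemma mass_nonneg: "0 \<le> mass \<nu>"
  by (rule imeas_nonneg) auto

lemma msr_mono: "S \<subseteq> T \<Longrightarrow> msr \<nu> S \<le> msr \<nu> T"
  by (rule imeas_mono) (auto simp: indicator_def)

lemma msr_le_mass: "msr \<nu> S \<le> mass \<nu>"
  by (rule imeas_mono) (auto simp: indicator_def)

lemma msr_Un_Int: "msr \<nu> (S \<union> T) + msr \<nu> (S \<inter> T) = msr \<nu> S + msr \<nu> T"
proof -
  have "msr \<nu> (S \<union> T) + msr \<nu> (S \<inter> T) = \<nu> (\<lambda>x. indicator (S \<union> T) x + indicator (S \<inter> T) x)"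
    by (subst imeas_add) auto
  also have "(\<lambda>x. indicator (S \<union> T) x + indicator (S \<inter> T) x :: real)
      = (\<lambda>x. indicator S x + indicator T x)"
    by (auto simp: indicator_def)
  finally show ?thesis by (simp add: imeas_add)
qed

lemma msr_Un_le: "msr \<nu> (S \<union> T) \<le> msr \<nu> S + msr \<nu> T"
  using msr_Un_Int[of S T] msr_nonneg[of "S \<inter> T"] by simp

lemma msr_empty [simp]: "msr \<nu> {} = 0"
proof -
  have "(indicator {} :: int \<Rightarrow> real) = (\<lambda>x. 0)" by auto
  thus ?thesis by simp
qed

lemma msr_Un_disjoint: "S \<inter> T = {} \<Longrightarrow> msr \<nu> (S \<union> T) = msr \<nu> S + msr \<nu> T"
  using msr_Un_Int[of S T] by simp

lemma msr_Diff: "msr \<nu> (S - T) = msr \<nu> S - msr \<nu> (S \<inter> T)"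
proof -
  have "(S - T) \<inter> (S \<inter> T) = {}" "(S - T) \<union> (S \<inter> T) = S" by auto
  thus ?thesis using msr_Un_disjoint[of "S - T" "S \<inter> T"] by simp
qed

lemma msr_UNIV: "msr \<nu> UNIV = mass \<nu>"
  by (simp add: indicator_def)

lemma msr_UN_le: "finite I \<Longrightarrow> msr \<nu> (\<Union>i\<in>I. S i) \<le> (\<Sum>i\<in>I. msr \<nu> (S i))"
proof (induction I rule: finite_induct)
  case (insert i I)
  thus ?case using msr_Un_le[of "S i" "\<Union>i\<in>I. S i"] by simp
qed simp

lemma msr_UN_disjoint:
  assumes "finite I" "\<And>i j. i \<in> I \<Longrightarrow> j \<in> I \<Longrightarrow> i \<noteq> j \<Longrightarrow> S i \<inter> S j = {}"
  shows "msr \<nu> (\<Union>i\<in>I. S i) = (\<Sum>i\<in>I. msr \<nu> (S i))"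
  using assms
proof (induction I rule: finite_induct)
  case (insert i I)
  have "S i \<inter> (\<Union>i\<in>I. S i) = {}" using insert by fastforce
  hence "msr \<nu> (\<Union>i\<in>insert i I. S i) = msr \<nu> (S i) + msr \<nu> (\<Union>i\<in>I. S i)"
    by (simp add: msr_Un_disjoint)
  thus ?case using insert by simp
qed simp

lemma msr_shift: "msr \<nu> {x. x + t \<in> S} = msr \<nu> S"
proof -
  have "(indicator {x. x + t \<in> S} :: int \<Rightarrow> real) = (\<lambda>x. indicator S (x + t))"
    by (auto simp: indicator_def)
  thus ?thesis by (simp add: imeas_shift)
qed

end

lemma imeasI:
  assumes "\<And>f g. bfun f \<Longrightarrow> bfun g \<Longrightarrow> \<nu> (\<lambda>x. f x + g x) = \<nu> f + \<nu> g"
    and "\<And>c f. bfun f \<Longrightarrow> \<nu> (\<lambda>x. c * f x) = c * \<nu> f"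
    and "\<And>f. bfun f \<Longrightarrow> (\<And>x. 0 \<le> f x) \<Longrightarrow> 0 \<le> \<nu> f"
    and "\<And>f t. bfun f \<Longrightarrow> \<nu> (\<lambda>x. f (x + t)) = \<nu> f"
  shows "imeas \<nu>"
  using assms unfolding imeas_def by blast

section \<open>Order on functionals and saturation\<close>

definition submeas :: "((int \<Rightarrow> real) \<Rightarrow> real) \<Rightarrow> ((int \<Rightarrow> real) \<Rightarrow> real) \<Rightarrow> bool" where
  "submeas \<mu> \<nu> \<longleftrightarrow> imeas \<mu> \<and> (\<forall>f. bfun f \<longrightarrow> (\<forall>x. 0 \<le> f x) \<longrightarrow> \<mu> f \<le> \<nu> f)"

text \<open>The analogue of having a bounded density with respect to \<open>\<nu>\<close>. Unlike
  \<open>submeas\<close> it survives rescaling, so normalized functionals and convolutions fall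
  under it.\<close>

definition dominated :: "((int \<Rightarrow> real) \<Rightarrow> real) \<Rightarrow> ((int \<Rightarrow> real) \<Rightarrow> real) \<Rightarrow> bool" where
  "dominated \<mu> \<nu> \<longleftrightarrow> imeas \<mu> \<and> (\<exists>c. \<forall>f. bfun f \<longrightarrow> (\<forall>x. 0 \<le> f x) \<longrightarrow> \<mu> f \<le> c * \<nu> f)"

lemma submeas_imp_dominated: "submeas \<mu> \<nu> \<Longrightarrow> dominated \<mu> \<nu>"
  unfolding submeas_def dominated_def by (metis mult_1)

lemma dominated_trans:
  assumes "imeas \<nu>" "dominated \<kappa> \<mu>" "dominated \<mu> \<nu>" shows "dominated \<kappa> \<nu>"
proof -
  obtain b where b: "\<And>f. bfun f \<Longrightarrow> \<forall>x. 0 \<le> f x \<Longrightarrow> \<kappa> f \<le> b * \<mu> f"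
    using assms(2) unfolding dominated_def by blast
  obtain c where c: "\<And>f. bfun f \<Longrightarrow> \<forall>x. 0 \<le> f x \<Longrightarrow> \<mu> f \<le> c * \<nu> f"
    using assms(3) unfolding dominated_def by blast
  have \<mu>: "imeas \<mu>" using assms(3) by (simp add: dominated_def)
  have "\<kappa> f \<le> (\<bar>b\<bar> * c) * \<nu> f" if f: "bfun f" "\<forall>x. 0 \<le> f x" for f
  proof -
    have "\<kappa> f \<le> b * \<mu> f" using b f by blast
    also have "\<dots> \<le> \<bar>b\<bar> * \<mu> f" using f imeas_nonneg[OF \<mu>, of f] by (intro mult_right_mono) auto
    also have "\<dots> \<le> \<bar>b\<bar> * (c * \<nu> f)" using c f by (intro mult_left_mono) auto
    finally show ?thesis by (simp add: mult.assoc)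
  qed
  thus ?thesis using assms(2) unfolding dominated_def by blast
qed

lemma imeas_diff_submeas:
  assumes "imeas \<nu>" "submeas \<mu> \<nu>"
  shows "imeas (\<lambda>f. \<nu> f - \<mu> f)"
proof -
  have \<mu>: "imeas \<mu>" using assms(2) by (simp add: submeas_def)
  show ?thesis
  proof (rule imeasI)
    fix f :: "int \<Rightarrow> real" assume "bfun f" "\<And>x. 0 \<le> f x"
    thus "0 \<le> \<nu> f - \<mu> f" using assms(2) by (simp add: submeas_def)
  qed (use assms(1) \<mu> in \<open>simp_all add: imeas_add imeas_cmult imeas_shift right_diff_distrib\<close>)
qed

lemma imeas_scale: "imeas \<mu> \<Longrightarrow> 0 \<le> c \<Longrightarrow> imeas (\<lambda>f. c * \<mu> f)"
  by (rule imeasI) (simp_all add: imeas_add imeas_cmult imeas_shift imeas_nonneg distrib_left)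

lemma imeas_glim:
  assumes \<nu>: "\<And>n. imeas (\<nu> n)" and M: "\<And>n. mass (\<nu> n) \<le> M"
  shows "imeas (\<lambda>f. glim (\<lambda>n. \<nu> n f))"
    and "bfun f \<Longrightarrow> bfun (\<lambda>n. \<nu> n f)"
proof -
  show b: "bfun (\<lambda>n. \<nu> n f)" if "bfun f" for f
  proof -
    obtain L where L: "L \<ge> 0" "\<And>x. \<bar>f x\<bar> \<le> L" using \<open>bfun f\<close> bfunE by blast
    have "\<bar>\<nu> n f\<bar> \<le> L * M" for n
      using imeas_abs_le[OF \<nu> L(2), of n] M[of n] L(1) by (meson mult_left_mono order_trans)
    thus ?thesis by (rule bfunI)
  qed
  show "imeas (\<lambda>f. glim (\<lambda>n. \<nu> n f))"
  proof (rule imeasI)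
    fix f :: "int \<Rightarrow> real" assume f: "bfun f" "\<And>x. 0 \<le> f x"
    have "glim (\<lambda>n. 0) \<le> glim (\<lambda>n. \<nu> n f)"
      using f b imeas_nonneg[OF \<nu>, of f] by (intro glim_mono[of _ _ 0]) auto
    thus "0 \<le> glim (\<lambda>n. \<nu> n f)" by simp
  qed (simp_all add: imeas_add[OF \<nu>] imeas_cmult[OF \<nu>] imeas_shift[OF \<nu>] b glim_add glim_cmult)
qed

text \<open>A substitute for the positive part of a Hahn decomposition: \<open>\<nu>\<close>
  maximizes the value at \<open>f\<close> among all functionals below \<open>\<rho>\<close>. If some
  dominated \<open>\<mu>\<close> were negative at \<open>f\<close>, subtracting a small multiple of
  \<open>\<mu>\<close> from \<open>\<nu>\<close> would stay below \<open>\<rho>\<close> and exceed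
  the maximum.\<close>

lemma saturation:
  assumes \<rho>: "imeas \<rho>" and f: "bfun f" and pos: "\<rho> f > 0"
  obtains \<nu> where "submeas \<nu> \<rho>" "\<nu> f > 0" "\<And>\<mu>. dominated \<mu> \<nu> \<Longrightarrow> \<mu> f \<ge> 0"
proof -
  define V where "V = {\<nu> f | \<nu>. submeas \<nu> \<rho>}"
  have sub_mass: "mass \<nu> \<le> mass \<rho>" if "submeas \<nu> \<rho>" for \<nu>
    using that by (simp add: submeas_def)
  obtain L where L: "L \<ge> 0" "\<And>x. \<bar>f x\<bar> \<le> L" using f bfunE by blast
  have V: "v \<le> L * mass \<rho>" if "v \<in> V" for v
  proof -
    obtain \<nu> where \<nu>: "submeas \<nu> \<rho>" "v = \<nu> f" using \<open>v \<in> V\<close> V_def by blast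
    have "\<nu> f \<le> L * mass \<nu>"
      using imeas_abs_le[OF _ L(2), of \<nu>] \<nu>(1) by (simp add: submeas_def abs_le_iff)
    also have "\<dots> \<le> L * mass \<rho>" using L(1) sub_mass[OF \<nu>(1)] by (rule mult_left_mono[rotated])
    finally show ?thesis using \<nu>(2) by simp
  qed
  hence bdd: "bdd_above V" by (rule bdd_aboveI)
  have \<rho>V: "\<rho> f \<in> V" unfolding V_def submeas_def using \<rho> by auto
  define s where "s = Sup V"
  have "\<exists>\<nu>. submeas \<nu> \<rho> \<and> \<nu> f > s - 1 / real (Suc n)" for n
  proof -
    have "\<exists>v\<in>V. s - 1 / real (Suc n) < v"
      using \<rho>V bdd unfolding s_def by (intro less_cSup_iff[THEN iffD1]) auto
    thus ?thesis unfolding V_def by blast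
  qed
  then obtain \<nu>s where \<nu>s: "\<And>n. submeas (\<nu>s n) \<rho>" "\<And>n. \<nu>s n f > s - 1 / real (Suc n)" by metis
  have \<nu>si: "imeas (\<nu>s n)" for n using \<nu>s(1) by (simp add: submeas_def)
  \<comment> \<open>The pointwise generalized limit of near maximizers plays the role of a weak
    limit and attains the supremum.\<close>
  define \<nu> where "\<nu> g = glim (\<lambda>n. \<nu>s n g)" for g
  have i\<nu>: "imeas \<nu>" and b\<nu>: "\<And>g. bfun g \<Longrightarrow> bfun (\<lambda>n. \<nu>s n g)"
    unfolding \<nu>_def by (rule imeas_glim[of \<nu>s "mass \<rho>"], use \<nu>si sub_mass \<nu>s(1) in auto)+
  have sub: "submeas \<nu> \<rho>"
    unfolding submeas_def
  proof (intro conjI allI impI i\<nu>)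
    fix g :: "int \<Rightarrow> real" assume g: "bfun g" "\<forall>x. 0 \<le> g x"
    have "\<nu> g \<le> glim (\<lambda>n. \<rho> g)"
      unfolding \<nu>_def using g \<nu>s(1) b\<nu>
      by (intro glim_mono[of _ _ 0]) (auto simp: submeas_def)
    thus "\<nu> g \<le> \<rho> g" by simp
  qed
  have "(\<lambda>n. s - 1 / real (Suc n)) \<longlonglongrightarrow> s"
    using tendsto_diff[OF tendsto_const LIMSEQ_inverse_real_of_nat, of s] by (simp add: inverse_eq_divide)
  from glim_tendsto[OF this] have "glim (\<lambda>n. s - 1 / real (Suc n)) = s" .
  moreover have "glim (\<lambda>n. s - 1 / real (Suc n)) \<le> \<nu> f"
    unfolding \<nu>_def
  proof (intro glim_mono[of _ _ 0] b\<nu>[OF f] bfunI[of _ "\<bar>s\<bar> + 1"])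
    show "\<bar>s - 1 / real (Suc n)\<bar> \<le> \<bar>s\<bar> + 1" for n
    proof -
      have "\<bar>1 / real (Suc n)\<bar> \<le> 1" by simp
      thus ?thesis using abs_triangle_ineq4[of s "1 / real (Suc n)"] by linarith
    qed
    show "s - 1 / real (Suc n) \<le> \<nu>s n f" for n using \<nu>s(2)[of n] by simp
  qed
  ultimately have s: "s \<le> \<nu> f" by simp
  show thesis
  proof
    show "submeas \<nu> \<rho>" by (rule sub)
    show "\<nu> f > 0" using s \<rho>V pos cSup_upper[OF \<rho>V bdd] by (simp add: s_def)
    show "\<mu> f \<ge> 0" if dom: "dominated \<mu> \<nu>" for \<mu>
    proof (rule ccontr)
      assume neg: "\<not> \<mu> f \<ge> 0"
      obtain c where c: "\<And>g. bfun g \<Longrightarrow> \<forall>x. 0 \<le> g x \<Longrightarrow> \<mu> g \<le> c * \<nu> g"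
        using dom unfolding dominated_def by blast
      \<comment> \<open>Small enough that \<open>b * \<mu>\<close> lies below \<open>\<nu>\<close>,
        so the difference is still a positive functional.\<close>
      define b where "b = 1 / (\<bar>c\<bar> + 1)"
      have b0: "b > 0" by (simp add: b_def add_nonneg_pos)
      have le: "b * \<mu> g \<le> \<nu> g" if g: "bfun g" "\<forall>x. 0 \<le> g x" for g
      proof -
        have "\<mu> g \<le> (\<bar>c\<bar> + 1) * \<nu> g"
          using c[OF g] imeas_nonneg[OF i\<nu>, of g] g
          by (smt (verit) mult_right_mono)
        thus ?thesis unfolding b_def by (simp add: field_simps add_nonneg_pos)
      qed
      have i\<mu>: "imeas (\<lambda>g. b * \<mu> g)"
        using dom b0 by (intro imeas_scale) (auto simp: dominated_def)
      have "submeas (\<lambda>g. b * \<mu> g) \<nu>" unfolding submeas_def using i\<mu> le by blast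
      hence "imeas (\<lambda>g. \<nu> g - b * \<mu> g)" by (rule imeas_diff_submeas[OF i\<nu>])
      moreover have "\<nu> g - b * \<mu> g \<le> \<rho> g" if g: "bfun g" "\<forall>x. 0 \<le> g x" for g
      proof -
        have "0 \<le> b * \<mu> g" using imeas_nonneg[OF i\<mu>, of g] g by auto
        moreover have "\<nu> g \<le> \<rho> g" using sub g by (simp add: submeas_def)
        ultimately show ?thesis by linarith
      qed
      ultimately have "submeas (\<lambda>g. \<nu> g - b * \<mu> g) \<rho>" unfolding submeas_def by blast
      hence "\<nu> f - b * \<mu> f \<in> V"
        unfolding V_def by (intro CollectI exI[of _ "\<lambda>g. \<nu> g - b * \<mu> g"]) simp
      hence "\<nu> f - b * \<mu> f \<le> s" unfolding s_def using bdd by (rule cSup_upper)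
      moreover have "b * \<mu> f < 0" using b0 neg by (simp add: mult_pos_neg)
      ultimately show False using s by linarith
    qed
  qed
qed

section \<open>The local structure of a saturated functional\<close>

definition residue_class :: "nat \<Rightarrow> int \<Rightarrow> int set" where
  "residue_class N c = {x. int N dvd x - c}"

text \<open>Averages, over the shift \<open>e\<close>, the restriction of \<open>\<nu>\<close> to
  the translate of \<open>T\<close> by \<open>- e\<close>; a translation of \<open>f\<close> is
  absorbed by the outer average. If the two averages could be exchanged, the result would be
  \<open>msr \<nu> T\<close> times \<open>\<nu>\<close>. For finitely additive functionals this
  fails in general, so a new functional arises, against which extremality of \<open>\<nu>\<close>
  can be tested.\<close>

definition convolution :: "((int \<Rightarrow> real) \<Rightarrow> real) \<Rightarrow> int set \<Rightarrow> (int \<Rightarrow> real) \<Rightarrow> real" where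
  "convolution \<nu> T f = \<nu> (\<lambda>e. \<nu> (\<lambda>x. f x * indicator T (x + e)))"

lemma bfun_convolution:
  assumes "imeas \<nu>" "bfun f"
  shows "bfun (\<lambda>e. \<nu> (\<lambda>x. f x * indicator T (x + e)))"
proof -
  obtain L where L: "L \<ge> 0" "\<And>x. \<bar>f x\<bar> \<le> L" using assms(2) bfunE by blast
  have "\<bar>\<nu> (\<lambda>x. f x * indicator T (x + e))\<bar> \<le> L * mass \<nu>" for e
    using L by (intro imeas_abs_le[OF assms(1)]) (simp add: indicator_def)
  thus ?thesis by (rule bfunI)
qed

lemma imeas_convolution:
  assumes \<nu>: "imeas \<nu>" shows "imeas (convolution \<nu> T)"
proof (rule imeasI)
  fix f g :: "int \<Rightarrow> real" assume "bfun f" "bfun g"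
  thus "convolution \<nu> T (\<lambda>x. f x + g x) = convolution \<nu> T f + convolution \<nu> T g"
    unfolding convolution_def distrib_right by (simp add: imeas_add[OF \<nu>] bfun_convolution[OF \<nu>])
next
  fix f :: "int \<Rightarrow> real" and c assume "bfun f"
  thus "convolution \<nu> T (\<lambda>x. c * f x) = c * convolution \<nu> T f"
    unfolding convolution_def mult.assoc by (simp add: imeas_cmult[OF \<nu>] bfun_convolution[OF \<nu>])
next
  fix f :: "int \<Rightarrow> real" assume "bfun f" "\<And>x. 0 \<le> f x"
  thus "0 \<le> convolution \<nu> T f"
    unfolding convolution_def by (intro imeas_nonneg[OF \<nu>] bfun_convolution[OF \<nu>]) auto
next
  fix f :: "int \<Rightarrow> real" and t assume f: "bfun f"
  have "\<nu> (\<lambda>x. f (x + t) * indicator T (x + e)) = \<nu> (\<lambda>x. f x * indicator T (x + (e + - t)))" for e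
    using imeas_shift[OF \<nu>, of "\<lambda>x. f x * indicator T (x + (e + - t))" t] f
    by (simp add: algebra_simps)
  hence "convolution \<nu> T (\<lambda>x. f (x + t)) = \<nu> (\<lambda>e. \<nu> (\<lambda>x. f x * indicator T (x + (e + - t))))"
    unfolding convolution_def by simp
  also have "\<dots> = convolution \<nu> T f"
    unfolding convolution_def by (rule imeas_shift[OF \<nu> bfun_convolution[OF \<nu> f]])
  finally show "convolution \<nu> T (\<lambda>x. f (x + t)) = convolution \<nu> T f" .
qed

lemma mass_convolution:
  assumes \<nu>: "imeas \<nu>" shows "mass (convolution \<nu> T) = msr \<nu> T * mass \<nu>"
proof -
  have "\<nu> (\<lambda>x. indicator T (x + e)) = msr \<nu> T" for e by (rule imeas_shift[OF \<nu>]) simp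
  thus ?thesis unfolding convolution_def using imeas_const[OF \<nu>, of "msr \<nu> T"] by simp
qed

lemma convolution_le:
  assumes \<nu>: "imeas \<nu>" and f: "bfun f" "\<forall>x. 0 \<le> f x"
  shows "convolution \<nu> T f \<le> mass \<nu> * \<nu> f"
proof -
  have "\<nu> (\<lambda>x. f x * indicator T (x + e)) \<le> \<nu> f" for e
  proof (rule imeas_mono[OF \<nu>])
    show "f x * indicator T (x + e) \<le> f x" for x using f(2) by (simp add: indicator_def)
  qed (use f(1) in auto)
  hence "convolution \<nu> T f \<le> \<nu> (\<lambda>e. \<nu> f)"
    unfolding convolution_def by (rule imeas_mono[OF \<nu> bfun_convolution[OF \<nu> f(1)] bfun_const])
  thus ?thesis using imeas_const[OF \<nu>, of "\<nu> f"] by (simp add: mult.commute)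
qed

lemma convolution_indicator:
  "convolution \<nu> T (indicator S) = \<nu> (\<lambda>e. msr \<nu> {x \<in> S. x + e \<in> T})"
proof -
  have "(\<lambda>x. indicator S x * indicator T (x + e) :: real) = indicator {x \<in> S. x + e \<in> T}" for e
    by (auto simp: indicator_def)
  thus ?thesis unfolding convolution_def by simp
qed

text \<open>The second set is the intersection of \<open>A\<close> with the translate of
  \<open>B\<close> by \<open>e\<close>, moved back by \<open>e\<close>; so this is
  inclusion-exclusion combined with invariance.\<close>

lemma dyson_msr:
  assumes "imeas \<nu>"
  shows "msr \<nu> (A \<union> {x. x - e \<in> B}) + msr \<nu> {b \<in> B. b + e \<in> A} = msr \<nu> A + msr \<nu> B"
proof -
  have "msr \<nu> {b \<in> B. b + e \<in> A} = msr \<nu> {x. x + e \<in> A \<inter> {x. x - e \<in> B}}"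
    by (rule arg_cong[where f = "msr \<nu>"]) auto
  also have "\<dots> = msr \<nu> (A \<inter> {x. x - e \<in> B})" by (rule msr_shift[OF assms])
  finally have 1: "msr \<nu> {b \<in> B. b + e \<in> A} = msr \<nu> (A \<inter> {x. x - e \<in> B})" .
  have "msr \<nu> {x. x - e \<in> B} = msr \<nu> B" using msr_shift[OF assms, of "-e" B] by simp
  thus ?thesis using msr_Un_Int[OF assms, of A "{x. x - e \<in> B}"] 1 by simp
qed

text \<open>Of \<open>m + 1\<close> translates of a set of measure at least \<open>2 / (m + 1)\<close> two overlap substantially;
  the inequality \<open>4 s \<le> s\<^sup>2 + 4\<close> for the sum \<open>s\<close> of the indicators replaces Bonferroni's.\<close>

lemma popular_multiple:
  assumes \<nu>: "imeas \<nu>" "mass \<nu> = 1" and B: "real (Suc m) * msr \<nu> B \<ge> 2"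
  obtains j where "1 \<le> j" "j \<le> m" "msr \<nu> {x \<in> B. x + int j * s \<in> B} \<ge> 1 / (real (Suc m))\<^sup>2"
proof (rule ccontr)
  assume neg: "\<not> thesis"
  \<comment> \<open>If no \<open>j\<close> works, the intersections of distinct translates add at
    most \<open>(real (Suc m))\<^sup>2 * r = 1\<close> to the integral of the squared sum. With s
    the integral of the sum this leads to 4 s \<le> s + 5, which contradicts s \<ge> 2.\<close>
  define r where "r = 1 / (real (Suc m))\<^sup>2"
  have r: "r > 0" by (simp add: r_def)
  have small: "msr \<nu> {x \<in> B. x + int j * s \<in> B} < r" if "1 \<le> j" "j \<le> m" for j
    using neg that \<open>\<And>j. \<lbrakk>1 \<le> j; j \<le> m; 1 / (real (Suc m))\<^sup>2 \<le> msr \<nu> {x \<in> B. x + int j * s \<in> B}\<rbrakk> \<Longrightarrow> thesis\<close>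
    unfolding r_def by (meson not_less)
  define X where "X i = {x. x + int i * s \<in> B}" for i :: nat
  have mX: "msr \<nu> (X i) = msr \<nu> B" for i unfolding X_def by (rule msr_shift[OF \<nu>(1)])
  have lt: "msr \<nu> (X i \<inter> X j) < r" if "i < j" "j \<le> m" for i j
  proof -
    have "X i \<inter> X j = {x. x + int i * s \<in> {x \<in> B. x + int (j - i) * s \<in> B}}"
      unfolding X_def using that by (auto simp: algebra_simps of_nat_diff)
    hence "msr \<nu> (X i \<inter> X j) = msr \<nu> {x \<in> B. x + int (j - i) * s \<in> B}"
      by (simp only: msr_shift[OF \<nu>(1)])
    thus ?thesis using small[of "j - i"] that by simp
  qed
  have pair: "msr \<nu> (X i \<inter> X j) \<le> r + (if i = j then msr \<nu> B else 0)" if "i \<le> m" "j \<le> m" for i j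
    using lt[of i j] lt[of j i] that mX[of i] r by (cases i j rule: linorder_cases) (auto simp: Int_commute)
  define S where "S x = (\<Sum>i\<le>m. indicator (X i) x :: real)" for x
  have S: "\<nu> S = real (Suc m) * msr \<nu> B"
    unfolding S_def by (subst imeas_sum[OF \<nu>(1)]) (simp_all add: mX)
  have bS: "bfun S" unfolding S_def by simp
  have "(\<lambda>x. S x * S x) = (\<lambda>x. \<Sum>i\<le>m. \<Sum>j\<le>m. indicator (X i \<inter> X j) x)"
    unfolding S_def sum_product by (simp add: indicator_inter_arith)
  hence "\<nu> (\<lambda>x. S x * S x) = (\<Sum>i\<le>m. \<Sum>j\<le>m. msr \<nu> (X i \<inter> X j))"
    by (simp add: imeas_sum[OF \<nu>(1)])
  also have "\<dots> \<le> (\<Sum>i\<le>m. \<Sum>j\<le>m. r + (if i = j then msr \<nu> B else 0))"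
    by (intro sum_mono pair) auto
  also have "\<dots> = (real (Suc m))\<^sup>2 * r + real (Suc m) * msr \<nu> B"
    by (simp add: sum.distrib power2_eq_square algebra_simps)
  also have "(real (Suc m))\<^sup>2 * r = 1" by (simp add: r_def)
  finally have sq: "\<nu> (\<lambda>x. S x * S x) \<le> 1 + \<nu> S" using S by simp
  have "\<nu> (\<lambda>x. 4 * S x) \<le> \<nu> (\<lambda>x. S x * S x + 4)"
  proof (rule imeas_mono[OF \<nu>(1)])
    show "4 * S x \<le> S x * S x + 4" for x
      using zero_le_square[of "S x - 2"] by (simp add: algebra_simps)
  qed (use bS in auto)
  hence "4 * \<nu> S \<le> \<nu> (\<lambda>x. S x * S x) + 4"
    using bS imeas_const[OF \<nu>(1), of 4] \<nu>(2) by (simp add: imeas_add[OF \<nu>(1)] imeas_cmult[OF \<nu>(1)])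
  thus False using sq B S by linarith
qed

text \<open>Pairs \<open>(A', B')\<close> with \<open>A' + B' \<subseteq> C\<close> are modified by Dyson's transform
  \<open>(A' \<union> (B' + e), B' \<inter> (A' - e))\<close>, \<open>e \<in> A'\<close>. Let \<open>msr \<nu> B'\<close> be nearly minimal over all such pairs
  and all normalized functionals \<open>\<nu>\<close> dominated by \<open>\<nu>0\<close>; saturation keeps the minimum \<open>\<beta>\<close> away from \<open>0\<close>.
  Minimality in the pair gives \<open>B' + e \<subseteq> A'\<close> up to a small error for every \<open>e \<in> A'\<close>. Minimality in \<open>\<nu>\<close>,
  tested on \<open>convolution \<nu> T\<close>, is an ergodicity property: \<open>B' + e\<close> meets \<open>T\<close> on average with
  measure at least \<open>\<beta>\<close> times that of \<open>T\<close>. For \<open>T = - A'\<close> this makes \<open>A'\<close> almost invariant under the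
  popular differences of \<open>B'\<close>, hence under all multiples of \<open>m!\<close>; for \<open>T\<close> the part of the class of
  \<open>a0\<close> outside \<open>A'\<close> it then forces \<open>T\<close> to be small.\<close>

lemma class_filled_approx:
  fixes A B C :: "int set"
  assumes \<nu>0: "imeas \<nu>0" "mass \<nu>0 > 0"
    and sat: "\<And>\<mu>. dominated \<mu> \<nu>0 \<Longrightarrow> msr \<mu> C + d * mass \<mu> \<le> msr \<mu> A + msr \<mu> B"
    and d: "d > 0" and m: "real (Suc m) * d \<ge> 2"
    and sub: "\<And>a b. a \<in> A \<Longrightarrow> b \<in> B \<Longrightarrow> a + b \<in> C"
    and a0: "a0 \<in> A" and b0: "0 \<in> B" and \<kappa>: "\<kappa> > 0"
  obtains \<mu> where "dominated \<mu> \<nu>0" "mass \<mu> = 1" "msr \<mu> (residue_class (fact m) a0 - C) \<le> \<kappa>"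
proof -
  \<comment> \<open>Every \<open>j\<close> between 1 and \<open>m\<close> divides \<open>N\<close>,
    so one modulus serves whichever multiple of a given shift turns out to be popular.\<close>
  define N :: nat where "N = fact m"
  define \<rho> where "\<rho> = 1 / (real (Suc m))\<^sup>2"
  have \<rho>: "\<rho> > 0" by (simp add: \<rho>_def)
  have N: "N \<ge> 1" unfolding N_def by (rule fact_ge_1)
  \<comment> \<open>The first bound leaves at least half of a popular intersection after a loss of
    \<open>\<epsilon>\<close>. The second keeps the final error
    \<open>2 * \<epsilon> + \<epsilon>'\<close> within \<open>\<kappa> * d\<close>; here
    \<open>\<epsilon>'\<close> accounts for up to \<open>N\<close> translations at a cost of
    \<open>2 * \<epsilon> / \<rho>\<close> each.\<close>
  define \<epsilon> where "\<epsilon> = min (\<rho> / 2) (\<kappa> * d / (2 + 2 * real N / \<rho>))"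
  define \<epsilon>' where "\<epsilon>' = real N * (2 * \<epsilon> / \<rho>)"
  have den: "2 + 2 * real N / \<rho> > 0" using \<rho> by (simp add: add_pos_nonneg)
  have \<epsilon>: "\<epsilon> > 0" "\<epsilon> \<le> \<rho> / 2"
    unfolding \<epsilon>_def using \<rho> \<kappa> d den by (simp, intro min.cobounded1)
  have "\<epsilon> * (2 + 2 * real N / \<rho>) \<le> \<kappa> * d"
    using den by (simp add: \<epsilon>_def pos_le_divide_eq[symmetric])
  hence \<epsilon>'d: "2 * \<epsilon> + \<epsilon>' \<le> \<kappa> * d" by (simp add: \<epsilon>'_def algebra_simps)
  have \<epsilon>'0: "\<epsilon>' \<ge> 0" using \<epsilon> \<rho> by (simp add: \<epsilon>'_def)

  define K where "K = {\<nu>. dominated \<nu> \<nu>0 \<and> mass \<nu> = 1}"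
  have normK: "(\<lambda>f. 1 / mass \<nu> * \<nu> f) \<in> K" if dom: "dominated \<nu> \<nu>0" and pos: "mass \<nu> > 0" for \<nu>
  proof -
    obtain c where c: "\<And>f. bfun f \<Longrightarrow> \<forall>x. 0 \<le> f x \<Longrightarrow> \<nu> f \<le> c * \<nu>0 f"
      using dom unfolding dominated_def by blast
    have "1 / mass \<nu> * \<nu> f \<le> (1 / mass \<nu> * c) * \<nu>0 f" if "bfun f" "\<forall>x. 0 \<le> f x" for f
      using mult_left_mono[OF c[OF that], of "1 / mass \<nu>"] pos by (simp add: mult.assoc)
    moreover have "imeas (\<lambda>f. 1 / mass \<nu> * \<nu> f)"
      using dom pos by (intro imeas_scale) (auto simp: dominated_def)
    ultimately have "dominated (\<lambda>f. 1 / mass \<nu> * \<nu> f) \<nu>0" unfolding dominated_def by blast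
    thus ?thesis using pos by (simp add: K_def)
  qed
  have K: "imeas \<nu>" "mass \<nu> = 1" "dominated \<nu> \<nu>0" if "\<nu> \<in> K" for \<nu>
    using that by (auto simp: K_def dominated_def)
  \<comment> \<open>The measure inequality is demanded on all of \<open>K\<close>, so that pair and
    functional can be varied independently. Dyson's transform preserves it because the sum of the
    two measures does not change.\<close>
  define good where "good A' B' \<longleftrightarrow> a0 \<in> A' \<and> 0 \<in> B' \<and> (\<forall>a\<in>A'. \<forall>b\<in>B'. a + b \<in> C) \<and>
      (\<forall>\<nu>\<in>K. msr \<nu> C + d \<le> msr \<nu> A' + msr \<nu> B')" for A' B'
  have goodAB: "good A B"
    unfolding good_def using a0 b0 sub sat K by fastforce
  \<comment> \<open>As 0 lies in \<open>B'\<close>, the set \<open>A'\<close> is contained in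
    \<open>C\<close>, so the surplus \<open>d\<close> must come from \<open>B'\<close>.\<close>
  have good_ge: "d \<le> msr \<nu> B'" if "good A' B'" "\<nu> \<in> K" for A' B' \<nu>
  proof -
    have "A' \<subseteq> C" using that(1) unfolding good_def by force
    thus ?thesis using that msr_mono[OF K(1), of \<nu> A' C] unfolding good_def by fastforce
  qed
  have dyson: "good (A' \<union> {x. x - e \<in> B'}) {b \<in> B'. b + e \<in> A'}" if "good A' B'" "e \<in> A'" for A' B' e
  proof -
    have "a + b \<in> C" if "a - e \<in> B'" "b + e \<in> A'" for a b
    proof -
      have "(b + e) + (a - e) \<in> C" using \<open>good A' B'\<close> that unfolding good_def by blast
      thus ?thesis by (simp add: algebra_simps)
    qed
    thus ?thesis using that unfolding good_def by (auto simp: dyson_msr K(1))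
  qed

  define V where "V = {msr \<nu> B' | \<nu> A' B'. \<nu> \<in> K \<and> good A' B'}"
  define \<beta> where "\<beta> = Inf V"
  have dom0: "dominated \<nu>0 \<nu>0" by (rule submeas_imp_dominated) (simp add: submeas_def \<nu>0)
  have V0: "V \<noteq> {}" unfolding V_def using normK[OF dom0 \<nu>0(2)] goodAB by blast
  have V: "d \<le> v" if "v \<in> V" for v using that good_ge unfolding V_def by blast
  have \<beta>d: "d \<le> \<beta>" unfolding \<beta>_def by (rule cInf_greatest[OF V0 V])
  have \<beta>: "\<beta> \<le> msr \<nu> B'" if "\<nu> \<in> K" "good A' B'" for \<nu> A' B'
    unfolding \<beta>_def using that by (intro cInf_lower bdd_belowI[of _ d] V) (auto simp: V_def)
  have "\<exists>v\<in>V. v < \<beta> + \<epsilon>"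
    using \<epsilon>(1) unfolding \<beta>_def by (intro cInf_lessD[OF V0]) simp
  then obtain \<nu> A' B' where \<nu>K: "\<nu> \<in> K" and good: "good A' B'" and near: "msr \<nu> B' < \<beta> + \<epsilon>"
    unfolding V_def by blast
  note \<nu> = K(1)[OF \<nu>K] K(2)[OF \<nu>K]
  have A'C: "A' \<subseteq> C" and a0': "a0 \<in> A'" using good unfolding good_def by force+

  \<comment> \<open>The transformed second set still has measure at least \<open>\<beta>\<close>,
    while \<open>B'\<close> exceeds \<open>\<beta>\<close> by less than
    \<open>\<epsilon>\<close>.\<close>
  have almost_in: "msr \<nu> {x \<in> B'. x + e \<notin> A'} \<le> \<epsilon>" if "e \<in> A'" for e
  proof -
    have "{x \<in> B'. x + e \<notin> A'} = B' - {x \<in> B'. x + e \<in> A'}" by auto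
    hence "msr \<nu> {x \<in> B'. x + e \<notin> A'} = msr \<nu> B' - msr \<nu> {x \<in> B'. x + e \<in> A'}"
      by (simp add: msr_Diff[OF \<nu>(1)] Int_absorb1 Collect_restrict)
    thus ?thesis using \<beta>[OF \<nu>K dyson[OF good that]] near by simp
  qed

  have convolution_ge: "msr \<nu> T * \<beta> \<le> convolution \<nu> T (indicator B')" for T
  proof (cases "msr \<nu> T = 0")
    case True
    thus ?thesis using imeas_nonneg[OF imeas_convolution[OF \<nu>(1)], of "indicator B'" T] by simp
  next
    case False
    hence T: "msr \<nu> T > 0" using msr_nonneg[OF \<nu>(1), of T] by simp
    have "dominated (convolution \<nu> T) \<nu>"
      unfolding dominated_def using imeas_convolution[OF \<nu>(1)] convolution_le[OF \<nu>(1)] by blast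
    hence "dominated (convolution \<nu> T) \<nu>0" using dominated_trans \<nu>0(1) K(3)[OF \<nu>K] by blast
    moreover have m: "mass (convolution \<nu> T) = msr \<nu> T" using mass_convolution[OF \<nu>(1)] \<nu>(2) by simp
    ultimately have "(\<lambda>f. 1 / msr \<nu> T * convolution \<nu> T f) \<in> K" using normK[of "convolution \<nu> T"] T by simp
    from \<beta>[OF this good] show ?thesis using T by (simp add: field_simps)
  qed

  define \<phi> where "\<phi> e = msr \<nu> {x \<in> B'. x + e \<in> A'}" for e
  have b\<phi>: "bfun \<phi>"
    unfolding \<phi>_def using msr_le_mass[OF \<nu>(1)]
    by (intro bfunI[of _ "mass \<nu>"]) (simp only: abs_of_nonneg[OF msr_nonneg[OF \<nu>(1)]])
  have \<phi>0: "0 \<le> \<phi> e" for e unfolding \<phi>_def by (rule msr_nonneg[OF \<nu>(1)])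
  \<comment> \<open>By \<open>convolution_ge\<close> for the complement of \<open>A'\<close>, the
    mean of \<open>\<phi>\<close> exceeds \<open>\<beta> * msr \<nu> A'\<close> by at most
    \<open>\<epsilon>\<close>. The points of \<open>A'\<close> already contribute
    \<open>\<beta> * msr \<nu> A'\<close>, since \<open>\<phi>\<close> is at least
    \<open>\<beta>\<close> there; only \<open>\<epsilon>\<close> is left for the points
    outside.\<close>
  have outside: "\<nu> (\<lambda>e. \<phi> e * indicator (- A') e) \<le> \<epsilon>"
  proof -
    have "msr \<nu> {x \<in> B'. x + e \<in> - A'} = msr \<nu> B' - \<phi> e" for e
    proof -
      have "{x \<in> B'. x + e \<in> - A'} = B' - {x \<in> B'. x + e \<in> A'}" by auto
      thus ?thesis by (simp add: msr_Diff[OF \<nu>(1)] \<phi>_def Int_absorb1 Collect_restrict)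
    qed
    hence "convolution \<nu> (- A') (indicator B') = \<nu> (\<lambda>e. msr \<nu> B' - \<phi> e)"
      by (simp add: convolution_indicator)
    also have "\<dots> = msr \<nu> B' - \<nu> \<phi>"
      using b\<phi> imeas_const[OF \<nu>(1), of "msr \<nu> B'"] \<nu>(2) by (simp add: imeas_diff[OF \<nu>(1)])
    finally have 1: "\<nu> \<phi> \<le> msr \<nu> B' - msr \<nu> (- A') * \<beta>" using convolution_ge[of "- A'"] by simp
    have "A' \<union> - A' = UNIV" "A' \<inter> - A' = {}" by auto
    hence "msr \<nu> A' + msr \<nu> (- A') = 1"
      using msr_Un_disjoint[OF \<nu>(1), of A' "- A'"] msr_UNIV[OF \<nu>(1)] \<nu>(2) by simp
    hence 2: "msr \<nu> (- A') * \<beta> = \<beta> - msr \<nu> A' * \<beta>" by (simp add: distrib_right[symmetric] eq_diff_eq add.commute)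
    have "\<nu> (\<lambda>e. \<beta> * indicator A' e) \<le> \<nu> (\<lambda>e. \<phi> e * indicator A' e)"
    proof (rule imeas_mono[OF \<nu>(1)])
      show "\<beta> * indicator A' e \<le> \<phi> e * indicator A' e" for e
        using \<beta>[OF \<nu>K dyson[OF good]] by (simp add: indicator_def \<phi>_def)
    qed (use b\<phi> in auto)
    hence 3: "\<beta> * msr \<nu> A' \<le> \<nu> (\<lambda>e. \<phi> e * indicator A' e)" by (simp add: imeas_cmult[OF \<nu>(1)])
    have "\<phi> = (\<lambda>e. \<phi> e * indicator A' e + \<phi> e * indicator (- A') e)"
      by (auto simp: indicator_def)
    hence "\<nu> \<phi> = \<nu> (\<lambda>e. \<phi> e * indicator A' e + \<phi> e * indicator (- A') e)" by (rule arg_cong)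
    also have "\<dots> = \<nu> (\<lambda>e. \<phi> e * indicator A' e) + \<nu> (\<lambda>e. \<phi> e * indicator (- A') e)"
      using b\<phi> by (simp add: imeas_add[OF \<nu>(1)])
    finally show ?thesis using 1 2 3 near by (simp add: mult.commute)
  qed

  \<comment> \<open>For \<open>e\<close> in \<open>A'\<close> the translate of \<open>B'\<close> by
    \<open>e\<close> lies almost inside \<open>A'\<close>, so \<open>e + t\<close> still moves at
    least \<open>\<rho> / 2\<close> of \<open>B'\<close> into \<open>A'\<close>. If
    \<open>e + t\<close> is outside \<open>A'\<close>, this mass is counted in
    \<open>outside\<close>, and Markov's inequality bounds how often that happens.\<close>
  have popular: "msr \<nu> {e \<in> A'. e + t \<notin> A'} \<le> 2 * \<epsilon> / \<rho>"
    if t: "msr \<nu> {x \<in> B'. x + t \<in> B'} \<ge> \<rho>" for t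
  proof -
    have \<phi>t: "\<rho> / 2 \<le> \<phi> (e + t)" if "e \<in> A'" for e
    proof -
      have "{x \<in> B'. x + t \<in> B'} \<subseteq> {x \<in> B'. x + (e + t) \<in> A'} \<union> {x. x + t \<in> {y \<in> B'. y + e \<notin> A'}}"
        by (auto simp: algebra_simps)
      hence "msr \<nu> {x \<in> B'. x + t \<in> B'} \<le> \<phi> (e + t) + msr \<nu> {x. x + t \<in> {y \<in> B'. y + e \<notin> A'}}"
        unfolding \<phi>_def by (intro order_trans[OF msr_mono[OF \<nu>(1)] msr_Un_le[OF \<nu>(1)]])
      also have "msr \<nu> {x. x + t \<in> {y \<in> B'. y + e \<notin> A'}} = msr \<nu> {y \<in> B'. y + e \<notin> A'}"
        by (rule msr_shift[OF \<nu>(1)])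
      finally show ?thesis using t almost_in[OF that] \<epsilon>(2) by linarith
    qed
    have "\<nu> (\<lambda>e. \<rho> / 2 * indicator {e \<in> A'. e + t \<notin> A'} e) \<le> \<nu> (\<lambda>e. \<phi> (e + t) * indicator (- A') (e + t))"
    proof (rule imeas_mono[OF \<nu>(1)])
      show "\<rho> / 2 * indicator {e \<in> A'. e + t \<notin> A'} e \<le> \<phi> (e + t) * indicator (- A') (e + t)" for e
        using \<phi>t \<phi>0 by (simp add: indicator_def)
    qed (intro bfun_mult bfun_const bfun_indicator bfun_indicator_comp bfun_shift[OF b\<phi>])+
    also have "\<dots> = \<nu> (\<lambda>e. \<phi> e * indicator (- A') e)"
      using b\<phi> by (intro imeas_shift[OF \<nu>(1)]) simp
    also have "\<dots> \<le> \<epsilon>" by (rule outside)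
    finally have "\<rho> / 2 * msr \<nu> {e \<in> A'. e + t \<notin> A'} \<le> \<epsilon>"
      by (simp only: imeas_cmult[OF \<nu>(1) bfun_indicator])
    thus ?thesis using \<rho> by (simp add: field_simps)
  qed
  have iterate: "msr \<nu> {e \<in> A'. e + int r * t \<notin> A'} \<le> real r * (2 * \<epsilon> / \<rho>)"
    if t: "msr \<nu> {x \<in> B'. x + t \<in> B'} \<ge> \<rho>" for t r
  proof (induction r)
    case 0
    have "{e \<in> A'. e + int 0 * t \<notin> A'} = {}" by auto
    thus ?case using msr_empty[OF \<nu>(1)] by (simp only: of_nat_0 mult_zero_left order_refl)
  next
    case (Suc r)
    have "{e \<in> A'. e + int (Suc r) * t \<notin> A'}
        \<subseteq> {e \<in> A'. e + int r * t \<notin> A'} \<union> {e. e + int r * t \<in> {e \<in> A'. e + t \<notin> A'}}"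
      by (auto simp: algebra_simps)
    hence "msr \<nu> {e \<in> A'. e + int (Suc r) * t \<notin> A'} \<le> msr \<nu> {e \<in> A'. e + int r * t \<notin> A'}
        + msr \<nu> {e. e + int r * t \<in> {e \<in> A'. e + t \<notin> A'}}"
      by (intro order_trans[OF msr_mono[OF \<nu>(1)] msr_Un_le[OF \<nu>(1)]])
    also have "msr \<nu> {e. e + int r * t \<in> {e \<in> A'. e + t \<notin> A'}} = msr \<nu> {e \<in> A'. e + t \<notin> A'}"
      by (rule msr_shift[OF \<nu>(1)])
    finally have "msr \<nu> {e \<in> A'. e + int (Suc r) * t \<notin> A'} \<le> real r * (2 * \<epsilon> / \<rho>) + 2 * \<epsilon> / \<rho>"
      using Suc popular[OF t] by linarith
    also have "\<dots> = real (Suc r) * (2 * \<epsilon> / \<rho>)"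
      by (simp only: of_nat_Suc distrib_right mult_1 add.commute)
    finally show ?case .
  qed
  have periodic: "msr \<nu> {e \<in> A'. e + int N * s \<notin> A'} \<le> \<epsilon>'" for s
  proof -
    have "2 \<le> real (Suc m) * msr \<nu> B'"
      using m mult_left_mono[OF good_ge[OF good \<nu>K], of "real (Suc m)"] by linarith
    then obtain j where j: "1 \<le> j" "j \<le> m" "msr \<nu> {x \<in> B'. x + int j * s \<in> B'} \<ge> \<rho>"
      unfolding \<rho>_def by (rule popular_multiple[OF \<nu>])
    have "j dvd N" unfolding N_def using j by (intro dvd_fact) auto
    then obtain r where r: "N = j * r" by (rule dvdE)
    have eq: "int N * s = int r * (int j * s)" by (simp add: r)
    have "msr \<nu> {e \<in> A'. e + int N * s \<notin> A'} \<le> real r * (2 * \<epsilon> / \<rho>)"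
      unfolding eq by (rule iterate[OF j(3)])
    also have "\<dots> \<le> \<epsilon>'"
    proof -
      have "r \<le> N" using r j(1) by simp
      thus ?thesis unfolding \<epsilon>'_def using \<epsilon> \<rho> by (intro mult_right_mono) auto
    qed
    finally show ?thesis .
  qed

  define D where "D = residue_class N a0 - A'"
  have small: "msr \<nu> {x \<in> B'. x + e \<in> D} \<le> 2 * \<epsilon> + \<epsilon>'" for e
  proof -
    define i where "i = a0 - e"
    have subi: "{x \<in> B'. x + e \<in> D} \<subseteq> B' \<inter> residue_class N i"
      unfolding D_def residue_class_def i_def by (auto simp: algebra_simps)
    show ?thesis
    proof (cases "msr \<nu> (B' \<inter> residue_class N i) \<le> 2 * \<epsilon>")
      case True
      thus ?thesis using msr_mono[OF \<nu>(1) subi] \<epsilon>'0 by linarith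
    next
      case False
      \<comment> \<open>In the class of \<open>i\<close>, the set \<open>B'\<close> has more mass
        than the exceptional set of any \<open>e'\<close> in \<open>A'\<close>. So from every point
        of \<open>A'\<close> a step by some element of that class stays in
        \<open>A'\<close>.\<close>
      have "\<exists>e'\<in>A'. e' \<in> residue_class N (a0 + int j * i)" for j
      proof (induction j)
        case 0 show ?case using a0' by (intro bexI[of _ a0]) (auto simp: residue_class_def)
      next
        case (Suc j)
        then obtain e' where e': "e' \<in> A'" "e' \<in> residue_class N (a0 + int j * i)" by blast
        have "\<not> B' \<inter> residue_class N i \<subseteq> {x \<in> B'. x + e' \<notin> A'}"
        proof
          assume "B' \<inter> residue_class N i \<subseteq> {x \<in> B'. x + e' \<notin> A'}"
          from msr_mono[OF \<nu>(1) this] show False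
            using almost_in[OF e'(1)] False \<epsilon>(1) by linarith
        qed
        then obtain x where x: "x \<in> residue_class N i" "x + e' \<in> A'" by blast
        have "int N dvd (x - i) + (e' - (a0 + int j * i))"
          using x(1) e'(2) unfolding residue_class_def by (intro dvd_add) auto
        hence "x + e' \<in> residue_class N (a0 + int (Suc j) * i)" unfolding residue_class_def by (simp add: algebra_simps)
        thus ?case using x(2) by blast
      qed
      \<comment> \<open>Modulo \<open>N\<close>, going \<open>N - 1\<close> steps of size
        \<open>i\<close> from \<open>a0\<close> is the same as going back one step, which leads to
        the class of \<open>e\<close>. The translate of \<open>B'\<close> by \<open>e1\<close> is
        almost inside \<open>A'\<close>, and the remaining shift \<open>e - e1\<close>, a multiple
        of \<open>N\<close>, costs at most \<open>\<epsilon>'\<close>.\<close>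
      then obtain e1 where e1: "e1 \<in> A'" "e1 \<in> residue_class N (a0 + int (N - 1) * i)" by blast
      have "int N dvd (e1 - (a0 + int (N - 1) * i)) + int N * i"
        using e1(2) unfolding residue_class_def by simp
      hence "int N dvd e1 - e" using N by (simp add: i_def algebra_simps of_nat_diff)
      hence "int N dvd e - e1" by (simp add: dvd_diff_commute)
      then obtain s where s: "e - e1 = int N * s" by (rule dvdE)
      have "{x \<in> B'. x + e \<in> D} \<subseteq> {x \<in> B'. x + e1 \<notin> A'} \<union> {x. x + e1 \<in> {y \<in> A'. y + int N * s \<notin> A'}}"
        unfolding D_def s[symmetric] by auto
      hence "msr \<nu> {x \<in> B'. x + e \<in> D} \<le> msr \<nu> {x \<in> B'. x + e1 \<notin> A'}
          + msr \<nu> {x. x + e1 \<in> {y \<in> A'. y + int N * s \<notin> A'}}"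
        by (intro order_trans[OF msr_mono[OF \<nu>(1)] msr_Un_le[OF \<nu>(1)]])
      also have "msr \<nu> {x. x + e1 \<in> {y \<in> A'. y + int N * s \<notin> A'}} = msr \<nu> {y \<in> A'. y + int N * s \<notin> A'}"
        by (rule msr_shift[OF \<nu>(1)])
      finally show ?thesis using almost_in[OF e1(1)] periodic[of s] \<epsilon>(1) by linarith
    qed
  qed
  have "msr \<nu> D * d \<le> msr \<nu> D * \<beta>"
    using \<beta>d msr_nonneg[OF \<nu>(1)] by (intro mult_left_mono)
  also have "\<dots> \<le> convolution \<nu> D (indicator B')" by (rule convolution_ge)
  also have "\<dots> \<le> \<nu> (\<lambda>e. 2 * \<epsilon> + \<epsilon>')"
    unfolding convolution_indicator
  proof (rule imeas_mono[OF \<nu>(1)])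
    show "bfun (\<lambda>e. msr \<nu> {x \<in> B'. x + e \<in> D})"
      by (rule bfunI[of _ "2 * \<epsilon> + \<epsilon>'"]) (use small msr_nonneg[OF \<nu>(1)] in auto)
  qed (use small in auto)
  also have "\<dots> \<le> \<kappa> * d" using \<epsilon>'d imeas_const[OF \<nu>(1), of "2 * \<epsilon> + \<epsilon>'"] \<nu>(2) by simp
  finally have "msr \<nu> D \<le> \<kappa>" using d by simp
  moreover have "msr \<nu> (residue_class N a0 - C) \<le> msr \<nu> D"
    unfolding D_def using A'C by (intro msr_mono[OF \<nu>(1)]) auto
  ultimately have "msr \<nu> (residue_class N a0 - C) \<le> \<kappa>" by linarith
  thus thesis using that K[OF \<nu>K] unfolding N_def by blast
qed

section \<open>The period of a sumset\<close>

definition periodic_hull :: "nat \<Rightarrow> int set \<Rightarrow> int set" where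
  "periodic_hull N C = {x. \<exists>c\<in>C. int N dvd x - c}"

definition periodic_set :: "nat \<Rightarrow> int set \<Rightarrow> bool" where
  "periodic_set k S \<longleftrightarrow> (\<forall>x y. int k dvd x - y \<longrightarrow> x \<in> S \<longrightarrow> y \<in> S)"

text \<open>Together with \<open>periodic_set k S\<close> this makes the stabilizer of
  \<open>S\<close> exactly the group of multiples of \<open>k\<close>; by itself it is one
  inclusion.\<close>

definition stab_gen :: "nat \<Rightarrow> int set \<Rightarrow> bool" where
  "stab_gen k S \<longleftrightarrow> (\<forall>t. (\<forall>x. x \<in> S \<longleftrightarrow> x + t \<in> S) \<longrightarrow> int k dvd t)"

lemma periodic_hull_eq: "C + multiples N = periodic_hull N C"
proof (intro equalityI subsetI)
  fix x assume "x \<in> periodic_hull N C"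
  then obtain c where c: "c \<in> C" "int N dvd x - c" unfolding periodic_hull_def by blast
  then obtain q where "x - c = int N * q" by (auto elim: dvdE)
  hence "x - c \<in> multiples N" unfolding multiples_def by blast
  from set_plus_intro[OF c(1) this] show "x \<in> C + multiples N" by simp
next
  fix x assume "x \<in> C + multiples N"
  then obtain c q where "c \<in> C" "x = c + int N * q" unfolding multiples_def set_plus_def by blast
  thus "x \<in> periodic_hull N C" unfolding periodic_hull_def by (intro CollectI bexI[of _ c]) auto
qed

lemma subset_periodic_hull: "C \<subseteq> periodic_hull N C"
  unfolding periodic_hull_def by force

lemma periodic_set_periodic_hull: "periodic_set N (periodic_hull N C)"
  unfolding periodic_set_def
proof (intro allI impI)
  fix x y assume xy: "int N dvd x - y" and "x \<in> periodic_hull N C"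
  then obtain c where c: "c \<in> C" "int N dvd x - c" unfolding periodic_hull_def by blast
  have "int N dvd y - c" using dvd_diff[OF c(2) xy] by simp
  thus "y \<in> periodic_hull N C" unfolding periodic_hull_def using c(1) by blast
qed

lemma periodic_hull_mult_subset: "k dvd N \<Longrightarrow> periodic_hull N C \<subseteq> periodic_hull k C"
  unfolding periodic_hull_def by (auto, meson dvd_trans of_nat_dvd_iff)

lemma periodic_hull_minimal: "periodic_set k S \<Longrightarrow> C \<subseteq> S \<Longrightarrow> periodic_hull k C \<subseteq> S"
  unfolding periodic_hull_def periodic_set_def by (auto simp: dvd_diff_commute)

lemma periodic_setI:
  assumes "\<And>x. x \<in> S \<longleftrightarrow> x + int k \<in> S" shows "periodic_set k S"
proof -
  have up: "x + int k * int j \<in> S \<longleftrightarrow> x \<in> S" for x j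
  proof (induction j)
    case (Suc j)
    thus ?case using assms[of "x + int k * int j"] by (simp add: algebra_simps)
  qed simp
  have "y \<in> S" if dvd: "int k dvd x - y" and x: "x \<in> S" for x y
  proof -
    obtain q where q: "x - y = int k * q" using dvd by (rule dvdE)
    show ?thesis
    proof (cases "q \<ge> 0")
      case True
      thus ?thesis using up[of y "nat q"] q x by (simp add: algebra_simps)
    next
      case False
      hence "int k * int (nat (-q)) = y - x" using q by (simp add: algebra_simps)
      thus ?thesis using up[of x "nat (-q)"] x by simp
    qed
  qed
  thus ?thesis unfolding periodic_set_def by blast
qed

lemma periodic_setD: "periodic_set k S \<Longrightarrow> int k dvd x - y \<Longrightarrow> x \<in> S \<longleftrightarrow> y \<in> S"
  unfolding periodic_set_def by (metis dvd_diff_commute)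

lemma periodic_set_dvd: "periodic_set k S \<Longrightarrow> k dvd l \<Longrightarrow> periodic_set l S"
  unfolding periodic_set_def by (meson dvd_trans of_nat_dvd_iff)

lemma periodic_set_Un: "periodic_set k S \<Longrightarrow> periodic_set k T \<Longrightarrow> periodic_set k (S \<union> T)"
  unfolding periodic_set_def by blast

text \<open>The least positive period works: the remainder of any period modulo it is again a
  period, hence 0.\<close>

lemma ex_stab_gen:
  assumes "k \<ge> 1" "periodic_set k S"
  obtains l where "l \<ge> 1" "periodic_set l S" "stab_gen l S" "l dvd k"
proof -
  define P where "P l \<longleftrightarrow> l \<ge> 1 \<and> (\<forall>x. x \<in> S \<longleftrightarrow> x + int l \<in> S)" for l :: nat
  define l where "l = (LEAST l. P l)"
  have "P k" unfolding P_def using assms periodic_setD[OF assms(2)] by simp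
  hence Pl: "P l" unfolding l_def by (rule LeastI)
  have l: "l \<ge> 1" "periodic_set l S" using Pl periodic_setI[of S l] by (auto simp: P_def)
  have st: "stab_gen l S"
    unfolding stab_gen_def
  proof (intro allI impI)
    fix t assume t: "\<forall>x. x \<in> S \<longleftrightarrow> x + t \<in> S"
    define s where "s = nat (t mod int l)"
    have s: "int s = t mod int l" "s < l" using l(1) by (auto simp: s_def nat_less_iff)
    have "x \<in> S \<longleftrightarrow> x + int s \<in> S" for x
    proof -
      have "int l dvd (x + t) - (x + int s)" by (simp add: s(1) minus_mod_eq_mult_div)
      thus ?thesis using t periodic_setD[OF l(2)] by blast
    qed
    moreover have "\<not> P s" using not_less_Least[of s P] s(2) unfolding l_def by blast
    ultimately have "\<not> s \<ge> 1" unfolding P_def by blast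
    hence "t mod int l = 0" using s(1) by simp
    thus "int l dvd t" by (rule mod_0_imp_dvd)
  qed
  moreover have "\<forall>x. x \<in> S \<longleftrightarrow> x + int k \<in> S" by (intro allI periodic_setD[OF assms(2)]) simp
  hence "int l dvd int k" using st unfolding stab_gen_def by blast
  ultimately show thesis using that l by simp
qed

lemma mem_residue_class_self [simp]: "c \<in> residue_class N c"
  by (simp add: residue_class_def)

lemma periodic_set_residue_class: "periodic_set N (residue_class N c)"
  using periodic_set_periodic_hull[of N "{c}"] by (simp add: periodic_hull_def residue_class_def)

lemma residue_class_subset: "periodic_set k S \<Longrightarrow> c \<in> S \<Longrightarrow> residue_class k c \<subseteq> S"
  unfolding periodic_set_def residue_class_def by (auto simp: dvd_diff_commute)

lemma periodic_set_eq_UN_residue_class: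
  assumes "k \<ge> 1" "periodic_set k S"
  shows "S = (\<Union>r\<in>S \<inter> {0..<int k}. residue_class k r)"
proof (intro equalityI subsetI)
  fix x assume x: "x \<in> S"
  have d: "int k dvd x - x mod int k" by (simp add: minus_mod_eq_mult_div)
  hence "x mod int k \<in> S \<inter> {0..<int k}" using x periodic_setD[OF assms(2) d] assms(1) by simp
  moreover have "x \<in> residue_class k (x mod int k)" using d by (simp add: residue_class_def)
  ultimately show "x \<in> (\<Union>r\<in>S \<inter> {0..<int k}. residue_class k r)" by blast
qed (use residue_class_subset[OF assms(2)] in blast)

lemma residue_class_disjoint:
  assumes "r \<in> {0..<int k}" "s \<in> {0..<int k}" "r \<noteq> s"
  shows "residue_class k r \<inter> residue_class k s = {}"
proof -
  have "r = s" if "int k dvd x - r" "int k dvd x - s" for x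
  proof -
    have "x mod int k = r mod int k" "x mod int k = s mod int k"
      using that by (simp_all add: mod_eq_dvd_iff)
    thus ?thesis using assms by simp
  qed
  thus ?thesis using assms(3) unfolding residue_class_def by blast
qed

section \<open>Measures of residue classes and periodic sets\<close>

context
  fixes \<nu> assumes \<nu>: "imeas \<nu>"
begin

lemma msr_residue_class:
  assumes "k \<ge> 1" shows "msr \<nu> (residue_class k r) = mass \<nu> / real k"
proof -
  have eq: "msr \<nu> (residue_class k r) = msr \<nu> (residue_class k 0)" for r
  proof -
    have "residue_class k r = {x. x + - r \<in> residue_class k 0}" by (auto simp: residue_class_def)
    thus ?thesis using msr_shift[OF \<nu>, of "- r" "residue_class k 0"] by simp
  qed
  have "UNIV = (\<Union>r\<in>UNIV \<inter> {0..<int k}. residue_class k r)"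
    by (rule periodic_set_eq_UN_residue_class[OF assms]) (simp add: periodic_set_def)
  hence U: "UNIV = (\<Union>r\<in>{0..<int k}. residue_class k r)" by simp
  have "mass \<nu> = msr \<nu> UNIV" by (simp add: msr_UNIV[OF \<nu>])
  also have "\<dots> = msr \<nu> (\<Union>r\<in>{0..<int k}. residue_class k r)" by (rule arg_cong[where f = "msr \<nu>"], rule U)
  also have "\<dots> = (\<Sum>r\<in>{0..<int k}. msr \<nu> (residue_class k r))"
    by (rule msr_UN_disjoint[OF \<nu>]) (use residue_class_disjoint in auto)
  also have "\<dots> = (\<Sum>r\<in>{0..<int k}. msr \<nu> (residue_class k 0))" by (intro sum.cong refl eq)
  also have "\<dots> = real k * msr \<nu> (residue_class k 0)" by simp
  finally show ?thesis using eq[of r] assms by (simp add: field_simps)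
qed

lemma msr_periodic_set:
  assumes "k \<ge> 1" "periodic_set k S"
  shows "msr \<nu> S = real (card (S \<inter> {0..<int k})) * mass \<nu> / real k"
proof -
  have "msr \<nu> S = msr \<nu> (\<Union>r\<in>S \<inter> {0..<int k}. residue_class k r)"
    by (rule arg_cong[where f = "msr \<nu>"], rule periodic_set_eq_UN_residue_class[OF assms])
  also have "\<dots> = (\<Sum>r\<in>S \<inter> {0..<int k}. msr \<nu> (residue_class k r))"
    by (rule msr_UN_disjoint[OF \<nu>]) (use residue_class_disjoint in auto)
  finally show ?thesis using assms by (simp add: msr_residue_class)
qed

end

text \<open>\<open>class_filled_approx\<close> yields only some dominated functional for which the
  class is almost filled. The passage to \<open>\<nu>0\<close> itself is by contradiction: if the
  missing part \<open>D\<close> had positive measure, a second saturation, now for \<open>f\<close>,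
  would give a functional such that everything normalized and dominated by it sees \<open>D\<close>
  with measure at least \<open>\<gamma>\<close>.\<close>

lemma saturated_class:
  fixes A B C :: "int set"
  assumes \<nu>0: "imeas \<nu>0"
    and sat: "\<And>\<mu>. dominated \<mu> \<nu>0 \<Longrightarrow> msr \<mu> C + d * mass \<mu> \<le> msr \<mu> A + msr \<mu> B"
    and d: "d > 0" and m: "real (Suc m) * d \<ge> 2"
    and sub: "\<And>a b. a \<in> A \<Longrightarrow> b \<in> B \<Longrightarrow> a + b \<in> C"
    and a0: "a0 \<in> A" and b0: "b0 \<in> B"
  shows "msr \<nu>0 (residue_class (fact m) (a0 + b0) - C) = 0"
proof (rule ccontr)
  define D where "D = residue_class (fact m) (a0 + b0) - C"
  define \<eta> where "\<eta> = msr \<nu>0 D"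
  assume "msr \<nu>0 (residue_class (fact m) (a0 + b0) - C) \<noteq> 0"
  hence \<eta>: "\<eta> > 0" using msr_nonneg[OF \<nu>0, of D] by (simp add: \<eta>_def D_def)
  hence mass: "mass \<nu>0 > 0" using msr_le_mass[OF \<nu>0, of D] by (simp add: \<eta>_def)
  \<comment> \<open>Half of the relative measure of \<open>D\<close>, so that
    \<open>\<nu>0 f\<close> remains positive.\<close>
  define \<gamma> where "\<gamma> = \<eta> / (2 * mass \<nu>0)"
  have \<gamma>: "\<gamma> > 0" using \<eta> mass by (simp add: \<gamma>_def)
  define f where "f x = indicator D x - \<gamma>" for x
  have bf: "bfun f" unfolding f_def by simp
  have f: "\<mu> f = msr \<mu> D - \<gamma> * mass \<mu>" if "imeas \<mu>" for \<mu>
    unfolding f_def using imeas_const[OF that, of \<gamma>] by (simp add: imeas_diff[OF that])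
  have "\<nu>0 f = \<eta> / 2" using f[OF \<nu>0] mass by (simp add: \<gamma>_def \<eta>_def)
  then obtain \<nu>1 where \<nu>1: "submeas \<nu>1 \<nu>0" "\<nu>1 f > 0" "\<And>\<mu>. dominated \<mu> \<nu>1 \<Longrightarrow> \<mu> f \<ge> 0"
    using saturation[OF \<nu>0 bf] \<eta> by (metis half_gt_zero)
  have i1: "imeas \<nu>1" using \<nu>1(1) by (simp add: submeas_def)
  have dom: "dominated \<mu> \<nu>0" if "dominated \<mu> \<nu>1" for \<mu>
    using dominated_trans[OF \<nu>0 that] submeas_imp_dominated \<nu>1(1) by blast
  have "msr \<nu>1 D > 0"
    using \<nu>1(2) f[OF i1] \<gamma> mass_nonneg[OF i1] by (smt (verit) mult_nonneg_nonneg)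
  hence m1: "mass \<nu>1 > 0" using msr_le_mass[OF i1, of D] by simp
  define B1 where "B1 = {x. x + b0 \<in> B}"
  define C1 where "C1 = {x. x + b0 \<in> C}"
  have sat1: "msr \<mu> C1 + d * mass \<mu> \<le> msr \<mu> A + msr \<mu> B1" if "dominated \<mu> \<nu>1" for \<mu>
  proof -
    have "imeas \<mu>" using that by (simp add: dominated_def)
    thus ?thesis using sat[OF dom[OF that]] unfolding B1_def C1_def by (simp add: msr_shift)
  qed
  have "a + b \<in> C1" if "a \<in> A" "b \<in> B1" for a b
    using that sub[of a "b + b0"] unfolding B1_def C1_def by (simp add: add.assoc)
  moreover have "0 \<in> B1" using b0 by (simp add: B1_def)
  moreover have "\<gamma> / 2 > 0" using \<gamma> by simp
  ultimately obtain \<mu> where \<mu>: "dominated \<mu> \<nu>1" "mass \<mu> = 1" "msr \<mu> (residue_class (fact m) a0 - C1) \<le> \<gamma> / 2"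
    using class_filled_approx[OF i1 m1 sat1 d m _ a0] by blast
  have i\<mu>: "imeas \<mu>" using \<mu>(1) by (simp add: dominated_def)
  have "residue_class (fact m) a0 - C1 = {x. x + b0 \<in> D}"
    unfolding residue_class_def C1_def D_def by auto
  hence "msr \<mu> D \<le> \<gamma> / 2" using \<mu>(3) msr_shift[OF i\<mu>, of b0 D] by simp
  moreover have "msr \<mu> D \<ge> \<gamma>" using \<nu>1(3)[OF \<mu>(1)] f[OF i\<mu>] \<mu>(2) by simp
  ultimately show False using \<gamma> by simp
qed

text \<open>The modulus \<open>fact m\<close> depends on \<open>d\<close> only, so it serves every
  point of \<open>A + B\<close> and finitely many residue classes have to be treated. This matters
  because null sets are closed under finite unions only.\<close>

lemma saturated_periodic:
  fixes A B :: "int set"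
  assumes \<nu>0: "imeas \<nu>0"
    and sat: "\<And>\<mu>. dominated \<mu> \<nu>0 \<Longrightarrow> msr \<mu> (A + B) + d * mass \<mu> \<le> msr \<mu> A + msr \<mu> B"
    and d: "d > 0"
  obtains N where "N \<ge> 1" "msr \<nu>0 (periodic_hull N (A + B) - (A + B)) = 0"
proof -
  \<comment> \<open>The second set keeps measure at least \<open>d\<close> under all Dyson
    transforms, so \<open>m + 1\<close> translates of it have total measure at least 2.\<close>
  obtain m :: nat where "2 / d \<le> real m" using real_arch_simple by blast
  hence m: "real (Suc m) * d \<ge> 2" using d by (simp add: field_simps)
  define C where "C = A + B"
  define N :: nat where "N = fact m"
  have N: "N \<ge> 1" unfolding N_def by (rule fact_ge_1)
  have z: "msr \<nu>0 (residue_class N c - C) = 0" if c: "c \<in> C" for c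
  proof -
    obtain a b where ab: "a \<in> A" "b \<in> B" "c = a + b"
      using c unfolding C_def set_plus_def by blast
    have "msr \<nu>0 (residue_class (fact m) (a + b) - C) = 0"
      by (rule saturated_class[OF \<nu>0 _ d m _ ab(1,2), of C]) (use sat in \<open>auto simp: C_def\<close>)
    thus ?thesis by (simp add: N_def ab(3))
  qed
  define R where "R = periodic_hull N C \<inter> {0..<int N}"
  have "periodic_hull N C - C = (\<Union>r\<in>R. residue_class N r - C)"
    unfolding R_def by (subst periodic_set_eq_UN_residue_class[OF N periodic_set_periodic_hull]) auto
  hence "msr \<nu>0 (periodic_hull N C - C) \<le> (\<Sum>r\<in>R. msr \<nu>0 (residue_class N r - C))"
    using msr_UN_le[OF \<nu>0, of R "\<lambda>r. residue_class N r - C"] by (simp add: R_def)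
  also have "\<dots> = 0"
  proof (rule sum.neutral, rule ballI)
    fix r assume "r \<in> R"
    then obtain c where c: "c \<in> C" "int N dvd r - c" by (auto simp: R_def periodic_hull_def)
    have "residue_class N r = residue_class N c"
      using c(2) residue_class_subset[OF periodic_set_residue_class, of r N c] residue_class_subset[OF periodic_set_residue_class, of c N r]
      by (auto simp: residue_class_def dvd_diff_commute)
    thus "msr \<nu>0 (residue_class N r - C) = 0" using z[OF c(1)] by simp
  qed
  finally have "msr \<nu>0 (periodic_hull N C - C) = 0" using msr_nonneg[OF \<nu>0, of "periodic_hull N C - C"] by simp
  thus thesis using that N unfolding C_def by blast
qed

text \<open>By \<open>local_period_unique\<close> the period is determined by \<open>C\<close>, whatever the functional; it is
  the number \<open>k\<close> of the theorem.\<close>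

definition local_period :: "int set \<Rightarrow> nat \<Rightarrow> bool" where
  "local_period C k \<longleftrightarrow> k \<ge> 1 \<and> stab_gen k (periodic_hull k C) \<and>
     (\<exists>\<nu>. imeas \<nu> \<and> mass \<nu> > 0 \<and> msr \<nu> (periodic_hull k C - C) = 0)"

lemma ex_local_period:
  assumes \<rho>: "imeas \<rho>" and pos: "msr \<rho> A + msr \<rho> B - msr \<rho> (A + B) > 0"
  obtains \<mu> k where "local_period (A + B) k" "submeas \<mu> \<rho>" "mass \<mu> > 0"
    "msr \<mu> (periodic_hull k (A + B) - (A + B)) = 0"
proof -
  have mass: "mass \<rho> > 0"
    using pos msr_le_mass[OF \<rho>, of A] msr_le_mass[OF \<rho>, of B] msr_nonneg[OF \<rho>, of "A + B"] by linarith
  \<comment> \<open>Half of the relative deficiency, which keeps \<open>\<rho> f\<close> positive.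
    Nonnegativity of \<open>\<kappa> f\<close> then says that \<open>\<kappa>\<close> has deficiency
    at least \<open>d\<close> times its mass.\<close>
  define d where "d = (msr \<rho> A + msr \<rho> B - msr \<rho> (A + B)) / (2 * mass \<rho>)"
  have d: "d > 0" using pos mass by (simp add: d_def)
  define f where "f x = (indicator A x + indicator B x) - (indicator (A + B) x + d)" for x
  have bf: "bfun f" unfolding f_def by simp
  have f: "\<mu> f = msr \<mu> A + msr \<mu> B - (msr \<mu> (A + B) + d * mass \<mu>)" if "imeas \<mu>" for \<mu>
    unfolding f_def using imeas_const[OF that, of d] by (simp add: imeas_diff[OF that] imeas_add[OF that])
  have "d * mass \<rho> = (msr \<rho> A + msr \<rho> B - msr \<rho> (A + B)) / 2"
    using mass by (simp add: d_def)
  hence "\<rho> f > 0" using f[OF \<rho>] pos by simp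
  then obtain \<mu> where \<mu>: "submeas \<mu> \<rho>" "\<mu> f > 0" "\<And>\<kappa>. dominated \<kappa> \<mu> \<Longrightarrow> \<kappa> f \<ge> 0"
    using saturation[OF \<rho> bf] by metis
  have i\<mu>: "imeas \<mu>" using \<mu>(1) by (simp add: submeas_def)
  have m\<mu>: "mass \<mu> > 0"
  proof -
    have "msr \<mu> A + msr \<mu> B > 0"
      using \<mu>(2) f[OF i\<mu>] d mass_nonneg[OF i\<mu>] msr_nonneg[OF i\<mu>, of "A + B"]
      by (smt (verit) mult_nonneg_nonneg)
    thus ?thesis using msr_le_mass[OF i\<mu>, of A] msr_le_mass[OF i\<mu>, of B] by linarith
  qed
  have "msr \<kappa> (A + B) + d * mass \<kappa> \<le> msr \<kappa> A + msr \<kappa> B" if "dominated \<kappa> \<mu>" for \<kappa>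
  proof -
    have "imeas \<kappa>" using that by (simp add: dominated_def)
    thus ?thesis using \<mu>(3)[OF that] f by fastforce
  qed
  then obtain N where N: "N \<ge> 1" "msr \<mu> (periodic_hull N (A + B) - (A + B)) = 0"
    using saturated_periodic[OF i\<mu> _ d] by metis
  \<comment> \<open>Passing to the least period of the hull leaves the hull unchanged, and with it
    the null set.\<close>
  obtain k where k: "k \<ge> 1" "periodic_set k (periodic_hull N (A + B))" "stab_gen k (periodic_hull N (A + B))" "k dvd N"
    using ex_stab_gen[OF N(1) periodic_set_periodic_hull] .
  have "periodic_hull k (A + B) = periodic_hull N (A + B)"
    using periodic_hull_minimal[OF k(2) subset_periodic_hull] periodic_hull_mult_subset[OF k(4)] by blast
  hence "local_period (A + B) k" "msr \<mu> (periodic_hull k (A + B) - (A + B)) = 0"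
    unfolding local_period_def using k N i\<mu> m\<mu> by auto
  thus thesis using that \<mu>(1) m\<mu> by blast
qed

text \<open>A point lying in only one of the two hulls brings along its whole class modulo
  \<open>k * l\<close>. That class avoids \<open>C\<close>, so it is part of a set that is null for
  some nonzero functional, which is impossible. Hence the hulls agree, and their common stabilizer
  makes \<open>k\<close> and \<open>l\<close> divide each other.\<close>

lemma local_period_unique:
  assumes "local_period C k" "local_period C l" shows "k = l"
proof -
  have sub: "periodic_hull k C \<subseteq> periodic_hull l C" if k: "local_period C k" and l: "local_period C l" for k l
  proof
    fix x assume x: "x \<in> periodic_hull k C"
    show "x \<in> periodic_hull l C"
    proof (rule ccontr)
      assume nx: "x \<notin> periodic_hull l C"
      obtain \<nu> where \<nu>: "imeas \<nu>" "mass \<nu> > 0" "msr \<nu> (periodic_hull k C - C) = 0"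
        using k unfolding local_period_def by blast
      have kl: "k * l \<ge> 1" using k l by (simp add: local_period_def)
      have "periodic_set (k * l) (periodic_hull k C)" "periodic_set (k * l) (periodic_hull l C)"
        using periodic_set_dvd[OF periodic_set_periodic_hull] by auto
      hence "residue_class (k * l) x \<subseteq> periodic_hull k C" "residue_class (k * l) x \<inter> periodic_hull l C = {}"
        using x nx residue_class_subset periodic_setD by (blast, auto simp: residue_class_def)
      hence "residue_class (k * l) x \<subseteq> periodic_hull k C - C" using subset_periodic_hull[of C l] by blast
      hence "msr \<nu> (residue_class (k * l) x) \<le> 0" using msr_mono[OF \<nu>(1)] \<nu>(3) by metis
      moreover have "0 < real (k * l)" using kl unfolding of_nat_0_less_iff by linarith
      hence "0 < mass \<nu> / real (k * l)" by (rule divide_pos_pos[OF \<nu>(2)])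
      ultimately show False using msr_residue_class[OF \<nu>(1) kl, of x] by linarith
    qed
  qed
  hence eq: "periodic_hull k C = periodic_hull l C" using assms by blast
  have "\<forall>x. x \<in> periodic_hull l C \<longleftrightarrow> x + int k \<in> periodic_hull l C" "\<forall>x. x \<in> periodic_hull k C \<longleftrightarrow> x + int l \<in> periodic_hull k C"
    using periodic_setD[OF periodic_set_periodic_hull[of k C]] periodic_setD[OF periodic_set_periodic_hull[of l C]] eq by auto
  hence "int l dvd int k" "int k dvd int l"
    using assms unfolding local_period_def stab_gen_def by blast+
  thus ?thesis by (simp add: dvd_antisym)
qed

section \<open>Kneser's theorem for periodic sets\<close>

text \<open>In a class modulo the gcd of two periods, a set \<open>S\<close> fills \<open>p\<close>
  out of \<open>a\<close> subclasses and a set \<open>T\<close> fills \<open>q\<close> out of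
  \<open>b\<close>; the products count what one set adds to the other. The unprimed cell has a point
  of \<open>T - S\<close>, the primed one a point of \<open>S - T\<close>. Interior cells follow
  from (u - 1) (v - 1) \<ge> 0; only the corners \<open>p = 0\<close>, \<open>q' = 0\<close> need
  both cells together.\<close>

lemma grid_inequality:
  fixes a b p q p' q' :: int
  assumes "1 \<le> q" "q \<le> b" "0 \<le> p" "p < a" "1 \<le> p'" "p' \<le> a" "0 \<le> q'" "q' < b"
  shows "b - 1 \<le> q * (a - p) \<or> a - 1 \<le> p * (b - q) \<or> b - 1 \<le> q' * (a - p') \<or> a - 1 \<le> p' * (b - q')"
proof -
  have pm: "u + v - 1 \<le> u * v" if "1 \<le> u" "1 \<le> v" for u v :: int
    using mult_nonneg_nonneg[of "u - 1" "v - 1"] that by (simp add: algebra_simps)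
  have inner: "b - 1 \<le> q * (a - p) \<or> a - 1 \<le> p * (b - q)" if "1 \<le> q" "q < b" "1 \<le> p" "p < a" for p q
    using pm[of q "a - p"] pm[of p "b - q"] that by linarith
  consider "q = b" | "q < b" "1 \<le> p" | "p = 0" using assms by linarith
  thus ?thesis
  proof cases
    case 1
    have "b * 1 \<le> b * (a - p)" using assms by (intro mult_left_mono) auto
    thus ?thesis using 1 by simp
  next
    case 2
    thus ?thesis using inner[of q p] assms by blast
  next
    case 3
    have qa: "1 * a \<le> q * (a - p)" unfolding 3 using assms by (intro mult_mono) auto
    consider "p' = a" | "p' < a" "1 \<le> q'" | "q' = 0" using assms by linarith
    thus ?thesis
    proof cases
      case 1
      have "a * 1 \<le> a * (b - q')" using assms by (intro mult_left_mono) auto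
      thus ?thesis using 1 by simp
    next
      case 2
      thus ?thesis using inner[of q' p'] assms by blast
    next
      case 3
      have "1 * b \<le> p' * (b - q')" unfolding 3 using assms by (intro mult_mono) auto
      thus ?thesis using qa by linarith
    qed
  qed
qed

lemma periodic_set_Int: "periodic_set k S \<Longrightarrow> periodic_set k T \<Longrightarrow> periodic_set k (S \<inter> T)"
  unfolding periodic_set_def by blast

lemma periodic_set_shift:
  assumes "periodic_set k S" shows "periodic_set k {x. x + t \<in> S}"
  unfolding periodic_set_def
proof (intro allI impI, elim CollectE, intro CollectI)
  fix x y assume "int k dvd x - y" "x + t \<in> S"
  thus "y + t \<in> S" using periodic_setD[OF assms, of "x + t" "y + t"] by simp
qed

text \<open>The Chinese remainder theorem for moduli with a common factor; Bezout's identity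
  supplies the common element \<open>z\<close>.\<close>

lemma residue_class_Int_residue_class:
  assumes "int (gcd k l) dvd i - j"
  obtains z where "residue_class k i \<inter> residue_class l j = residue_class (lcm k l) z"
proof -
  obtain u v where "u * int k + v * int l = gcd (int k) (int l)" using bezout_int by blast
  hence uv: "u * int k + v * int l = int (gcd k l)" by (simp add: gcd_int_int_eq)
  obtain t where t: "i - j = int (gcd k l) * t" using assms by (rule dvdE)
  define z where "z = i - int k * (u * t)"
  have zi: "int k dvd z - i" by (simp add: z_def)
  have "z - j = (u * int k + v * int l) * t - int k * (u * t)" by (simp add: uv z_def t[symmetric])
  also have "\<dots> = int l * (v * t)" by (simp add: algebra_simps)
  finally have zj: "int l dvd z - j" by simp
  have "int k dvd x - i \<longleftrightarrow> int k dvd x - z" "int l dvd x - j \<longleftrightarrow> int l dvd x - z" for x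
    using dvd_add[OF _ zi, of "x - z"] dvd_diff[OF _ zi, of "x - i"]
      dvd_add[OF _ zj, of "x - z"] dvd_diff[OF _ zj, of "x - j"] by auto
  moreover have "int (lcm k l) dvd y \<longleftrightarrow> int k dvd y \<and> int l dvd y" for y
    using lcm_least_iff[of "int k" "int l" y] by (simp add: lcm_int_int_eq)
  ultimately have "residue_class k i \<inter> residue_class l j = residue_class (lcm k l) z" unfolding residue_class_def by auto
  thus thesis by (rule that)
qed

context
  fixes \<nu> assumes \<nu>: "imeas \<nu>" "mass \<nu> = 1"
begin

text \<open>Within one class modulo the gcd, each subclass modulo \<open>k\<close> meets each
  subclass modulo \<open>l\<close> in exactly one class modulo the lcm: there the two sets behave
  like independent events.\<close>

lemma msr_Int_periodic_set:
  fixes k l r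
  defines "g \<equiv> gcd k l"
  assumes k: "k \<ge> 1" "periodic_set k S" and l: "l \<ge> 1" "periodic_set l T"
    and S: "S \<subseteq> residue_class g r" and T: "T \<subseteq> residue_class g r"
  shows "msr \<nu> (S \<inter> T) = real (card (S \<inter> {0..<int k})) * real (card (T \<inter> {0..<int l})) / real (lcm k l)"
proof -
  define I where "I = S \<inter> {0..<int k}"
  define J where "J = T \<inter> {0..<int l}"
  have "lcm k l > 0" using k l by (simp add: lcm_pos_nat)
  hence lcm: "lcm k l \<ge> 1" by linarith
  have SU: "S = (\<Union>i\<in>I. residue_class k i)" unfolding I_def by (rule periodic_set_eq_UN_residue_class[OF k])
  have TU: "T = (\<Union>j\<in>J. residue_class l j)" unfolding J_def by (rule periodic_set_eq_UN_residue_class[OF l])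
  have "S \<inter> T = (\<Union>p\<in>I \<times> J. residue_class k (fst p) \<inter> residue_class l (snd p))"
    by (subst SU, subst TU) auto
  hence "msr \<nu> (S \<inter> T) = msr \<nu> (\<Union>p\<in>I \<times> J. residue_class k (fst p) \<inter> residue_class l (snd p))" by simp
  also have "\<dots> = (\<Sum>p\<in>I \<times> J. msr \<nu> (residue_class k (fst p) \<inter> residue_class l (snd p)))"
  proof (rule msr_UN_disjoint[OF \<nu>(1)])
    show "finite (I \<times> J)" by (simp add: I_def J_def)
    fix p q assume "p \<in> I \<times> J" "q \<in> I \<times> J" "p \<noteq> q"
    thus "residue_class k (fst p) \<inter> residue_class l (snd p) \<inter> (residue_class k (fst q) \<inter> residue_class l (snd q)) = {}"
      using residue_class_disjoint[of "fst p" k "fst q"] residue_class_disjoint[of "snd p" l "snd q"]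
      unfolding I_def J_def by (cases p; cases q) auto
  qed
  also have "\<dots> = (\<Sum>p\<in>I \<times> J. 1 / real (lcm k l))"
  proof (rule sum.cong)
    fix p assume p: "p \<in> I \<times> J"
    hence "fst p \<in> residue_class g r" "snd p \<in> residue_class g r" using S T unfolding I_def J_def by auto
    hence "int g dvd fst p - r" "int g dvd snd p - r" by (simp_all add: residue_class_def)
    from dvd_diff[OF this] have "int (gcd k l) dvd fst p - snd p" by (simp add: g_def)
    then obtain z where "residue_class k (fst p) \<inter> residue_class l (snd p) = residue_class (lcm k l) z" by (rule residue_class_Int_residue_class)
    thus "msr \<nu> (residue_class k (fst p) \<inter> residue_class l (snd p)) = 1 / real (lcm k l)"
      using msr_residue_class[OF \<nu>(1) lcm, of z] \<nu>(2) by simp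
  qed simp
  finally show ?thesis by (simp add: I_def J_def card_cartesian_product)
qed

text \<open>The union lemma of Kneser's theorem: measure plus reciprocal period does not fall below
  the smaller of the two given values. With \<open>n\<close> the lcm, the period term drops by
  \<open>(b - 1) / n\<close> from \<open>S\<close> and by \<open>(a - 1) / n\<close> from
  \<open>T\<close>; the loss must be made up by \<open>T - S\<close> or by \<open>S - T\<close>,
  respectively. Counting inside single classes modulo the gcd shows that one of the two is large
  enough.\<close>

lemma periodic_set_union_step:
  assumes k: "k \<ge> 1" "periodic_set k S" and l: "l \<ge> 1" "periodic_set l T"
    and s: "s \<le> msr \<nu> S + 1 / real k" "s \<le> msr \<nu> T + 1 / real l"
  obtains n where "n \<ge> 1" "periodic_set n (S \<union> T)" "s \<le> msr \<nu> (S \<union> T) + 1 / real n"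
proof -
  consider "S \<subseteq> T" | "T \<subseteq> S" | "\<not> S \<subseteq> T" "\<not> T \<subseteq> S" by blast
  thus thesis
  proof cases
    case 1
    hence "S \<union> T = T" by blast
    thus thesis using that[OF l(1)] l(2) s(2) by simp
  next
    case 2
    hence "S \<union> T = S" by blast
    thus thesis using that[OF k(1)] k(2) s(1) by simp
  next
    case 3
    define g where "g = gcd k l"
    define n where "n = lcm k l"
    have "n > 0" unfolding n_def using k l by (simp add: lcm_pos_nat)
    hence n1: "n \<ge> 1" by linarith
    have g: "g dvd k" "g dvd l" by (simp_all add: g_def)
    obtain a b where ab: "k = g * a" "l = g * b" using g by (meson dvdE)
    have g0: "g \<noteq> 0" using ab k(1) by auto
    have "g * n = k * l" unfolding g_def n_def by (rule prod_gcd_lcm_nat[symmetric])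
    hence n: "n = g * a * b" using g0 ab by simp
    define u where "u r = card (S \<inter> residue_class g r \<inter> {0..<int k})" for r
    define v where "v r = card (T \<inter> residue_class g r \<inter> {0..<int l})" for r
    have perS: "periodic_set k (S \<inter> residue_class g r)" and perT: "periodic_set l (T \<inter> residue_class g r)" for r
      using k l g periodic_set_dvd[OF periodic_set_residue_class] by (auto intro: periodic_set_Int)
    have full: "msr \<nu> (residue_class g r) = 1 / real g" for r
      using msr_residue_class[OF \<nu>(1), of g r] \<nu>(2) g0 by simp
    have mS: "msr \<nu> (S \<inter> residue_class g r) = real (u r) / real k" for r
      using msr_periodic_set[OF \<nu>(1) k(1) perS, of r] \<nu>(2) by (simp add: u_def)
    have mT: "msr \<nu> (T \<inter> residue_class g r) = real (v r) / real l" for r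
      using msr_periodic_set[OF \<nu>(1) l(1) perT, of r] \<nu>(2) by (simp add: v_def)
    have mST: "msr \<nu> (S \<inter> T \<inter> residue_class g r) = real (u r) * real (v r) / real n" for r
    proof -
      have "S \<inter> T \<inter> residue_class g r = (S \<inter> residue_class g r) \<inter> (T \<inter> residue_class g r)" by blast
      thus ?thesis
        using msr_Int_periodic_set[OF k(1) perS l(1) perT, of r r r] by (simp add: u_def v_def g_def n_def)
    qed
    have a0: "a \<ge> 1" and b0: "b \<ge> 1" using ab k l by (auto simp: Suc_le_eq intro: Nat.gr0I)
    have un: "real (u r) / real k = real (u r) * real b / real n" for r
      using a0 b0 g0 by (simp add: ab n)
    have vn: "real (v r) / real l = real (v r) * real a / real n" for r
      using a0 b0 g0 by (simp add: ab n)
    have TS: "msr \<nu> ((T - S) \<inter> residue_class g r) = real (v r) * (real a - real (u r)) / real n" for r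
    proof -
      have "(T - S) \<inter> residue_class g r = T \<inter> residue_class g r - S \<inter> T \<inter> residue_class g r"
        "T \<inter> residue_class g r \<inter> (S \<inter> T \<inter> residue_class g r) = S \<inter> T \<inter> residue_class g r" by auto
      thus ?thesis by (simp add: msr_Diff[OF \<nu>(1)] mT mST vn diff_divide_distrib[symmetric] algebra_simps)
    qed
    have ST: "msr \<nu> ((S - T) \<inter> residue_class g r) = real (u r) * (real b - real (v r)) / real n" for r
    proof -
      have "(S - T) \<inter> residue_class g r = S \<inter> residue_class g r - S \<inter> T \<inter> residue_class g r"
        "S \<inter> residue_class g r \<inter> (S \<inter> T \<inter> residue_class g r) = S \<inter> T \<inter> residue_class g r" by auto
      thus ?thesis by (simp add: msr_Diff[OF \<nu>(1)] mS mST un diff_divide_distrib[symmetric] algebra_simps)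
    qed
    have ua: "u r \<le> a" for r
    proof -
      have "real (u r) / real k \<le> 1 / real g" using msr_mono[OF \<nu>(1), of "S \<inter> residue_class g r" "residue_class g r"] mS full by simp
      thus ?thesis using g0 a0 by (simp add: ab field_simps)
    qed
    have vb: "v r \<le> b" for r
    proof -
      have "real (v r) / real l \<le> 1 / real g" using msr_mono[OF \<nu>(1), of "T \<inter> residue_class g r" "residue_class g r"] mT full by simp
      thus ?thesis using g0 b0 by (simp add: ab field_simps)
    qed
    have pos: "msr \<nu> (X \<inter> residue_class g r) > 0" if "periodic_set n X" "r \<in> X" for X r
    proof -
      have "g dvd n" by (simp add: n)
      hence "residue_class n r \<subseteq> X \<inter> residue_class g r"
        using residue_class_subset[OF periodic_set_Int[OF that(1) periodic_set_dvd[OF periodic_set_residue_class]], of g r r] that(2) by simp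
      hence "msr \<nu> (residue_class n r) \<le> msr \<nu> (X \<inter> residue_class g r)" by (rule msr_mono[OF \<nu>(1)])
      moreover have "msr \<nu> (residue_class n r) > 0" using msr_residue_class[OF \<nu>(1) n1, of r] \<nu>(2) n1 by simp
      ultimately show ?thesis by linarith
    qed
    have pn: "periodic_set n S" "periodic_set n T" using k l periodic_set_dvd by (auto simp: n_def)
    have pd: "periodic_set n (T - S)" "periodic_set n (S - T)" using pn unfolding periodic_set_def by (meson DiffD1 DiffD2 DiffI dvd_diff_commute)+
    obtain r where r: "r \<in> T - S" using 3 by blast
    obtain r' where r': "r' \<in> S - T" using 3 by blast
    have "real (v r) * (real a - real (u r)) > 0"
      using pos[OF pd(1) r] unfolding TS by (simp add: zero_less_divide_iff)
    hence 1: "1 \<le> v r" "u r < a" by (auto simp: zero_less_mult_iff)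
    have "real (u r') * (real b - real (v r')) > 0"
      using pos[OF pd(2) r'] unfolding ST by (simp add: zero_less_divide_iff)
    hence 2: "1 \<le> u r'" "v r' < b" by (auto simp: zero_less_mult_iff)
    have le: "msr \<nu> (X \<inter> residue_class g r) \<le> msr \<nu> X" for X r by (rule msr_mono[OF \<nu>(1)]) blast
    have up: "msr \<nu> (S \<union> T) = msr \<nu> S + msr \<nu> (T - S)" "msr \<nu> (S \<union> T) = msr \<nu> T + msr \<nu> (S - T)"
      using msr_Un_disjoint[OF \<nu>(1), of S "T - S"] msr_Un_disjoint[OF \<nu>(1), of T "S - T"]
      by (simp_all add: Un_commute)
    have kn: "1 / real k = real b / real n" "1 / real l = real a / real n"
      using a0 b0 g0 by (simp_all add: ab n)
    have fin1: "s \<le> msr \<nu> (S \<union> T) + 1 / real n" if "int b - 1 \<le> int (v r) * (int a - int (u r))" for r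
    proof -
      have "real_of_int (int b - 1) \<le> real_of_int (int (v r) * (int a - int (u r)))"
        using that by (simp only: of_int_le_iff)
      hence "real b - 1 \<le> real (v r) * (real a - real (u r))" by simp
      hence "(real b - 1) / real n \<le> real (v r) * (real a - real (u r)) / real n"
        by (rule divide_right_mono) simp
      also have "\<dots> = msr \<nu> ((T - S) \<inter> residue_class g r)" by (simp only: TS)
      also have "\<dots> \<le> msr \<nu> (T - S)" by (rule le)
      finally have "(real b - 1) / real n \<le> msr \<nu> (T - S)" .
      thus ?thesis using s(1) up(1) kn(1) by (simp add: diff_divide_distrib)
    qed
    have fin2: "s \<le> msr \<nu> (S \<union> T) + 1 / real n" if "int a - 1 \<le> int (u r) * (int b - int (v r))" for r
    proof -
      have "real_of_int (int a - 1) \<le> real_of_int (int (u r) * (int b - int (v r)))"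
        using that by (simp only: of_int_le_iff)
      hence "real a - 1 \<le> real (u r) * (real b - real (v r))" by simp
      hence "(real a - 1) / real n \<le> real (u r) * (real b - real (v r)) / real n"
        by (rule divide_right_mono) simp
      also have "\<dots> = msr \<nu> ((S - T) \<inter> residue_class g r)" by (simp only: ST)
      also have "\<dots> \<le> msr \<nu> (S - T)" by (rule le)
      finally have "(real a - 1) / real n \<le> msr \<nu> (S - T)" .
      thus ?thesis using s(2) up(2) kn(2) by (simp add: diff_divide_distrib)
    qed
    have "s \<le> msr \<nu> (S \<union> T) + 1 / real n"
      using grid_inequality[of "int (v r)" "int b" "int (u r)" "int a" "int (u r')" "int (v r')"]
        1 2 ua[of r'] vb[of r] fin1 fin2 by auto
    thus thesis using that[OF n1 periodic_set_Un[OF pn]] by blast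
  qed
qed

text \<open>Dyson's transform is repeated as long as some \<open>e + b\<close> leaves
  \<open>A\<close>; each time the class of \<open>b\<close> drops out of \<open>B\<close>, so this
  ends. Then \<open>A + B\<close> is contained in \<open>A\<close>, so \<open>B\<close> consists of
  periods of \<open>A\<close> and has measure at most \<open>1 / l\<close> for the least period
  \<open>l\<close>. The point \<open>a\<close> is kept throughout, so that the sets \<open>D\<close>
  for different points can cover a sumset.\<close>

lemma dyson_periodic_class:
  assumes "k \<ge> 1" "periodic_set k A" "periodic_set k B" "a \<in> A" "0 \<in> B" "\<And>x y. x \<in> A \<Longrightarrow> y \<in> B \<Longrightarrow> x + y \<in> C"
  shows "\<exists>D l. periodic_set k D \<and> D \<subseteq> C \<and> a \<in> D \<and> l \<ge> 1 \<and> periodic_set l D \<and> msr \<nu> A + msr \<nu> B \<le> msr \<nu> D + 1 / real l"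
  using assms
proof (induction "card (B \<inter> {0..<int k})" arbitrary: A B rule: less_induct)
  case less
  show ?case
  proof (cases "\<forall>e\<in>A. \<forall>b\<in>B. e + b \<in> A")
    case True
    obtain l where l: "l \<ge> 1" "periodic_set l A" "stab_gen l A" using ex_stab_gen[OF less.prems(1,2)] by blast
    have up: "e + int j * b \<in> A" if "e \<in> A" "b \<in> B" for e b j
    proof (induction j)
      case (Suc j)
      hence "(e + int j * b) + b \<in> A" using True that(2) by blast
      thus ?case by (simp add: algebra_simps)
    qed (use that in simp)
    have "int l dvd b" if b: "b \<in> B" for b
    proof -
      have "x \<in> A \<longleftrightarrow> x + b \<in> A" for x
      proof
        assume "x + b \<in> A"
        \<comment> \<open>Together with the first step these are \<open>k\<close> steps by
          \<open>b\<close>, which lead back to the class of \<open>x\<close> modulo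
          \<open>k\<close>.\<close>
        hence "(x + b) + int (k - 1) * b \<in> A" using b by (rule up)
        moreover have "int k dvd ((x + b) + int (k - 1) * b) - x"
          using less.prems(1) by (simp add: algebra_simps of_nat_diff)
        ultimately show "x \<in> A" using periodic_setD[OF less.prems(2)] by blast
      qed (use True b in auto)
      thus ?thesis using l(3) unfolding stab_gen_def by blast
    qed
    hence "B \<subseteq> residue_class l 0" by (auto simp: residue_class_def)
    hence "msr \<nu> B \<le> 1 / real l" using msr_mono[OF \<nu>(1)] msr_residue_class[OF \<nu>(1) l(1), of 0] \<nu>(2) by metis
    moreover have "A \<subseteq> C" using less.prems(5,6) by force
    ultimately show ?thesis using less.prems(2,4) l by (intro exI[of _ A] exI[of _ l]) auto
  next
    case False
    then obtain e b where eb: "e \<in> A" "b \<in> B" "e + b \<notin> A" by blast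
    define A' where "A' = A \<union> {x. x - e \<in> B}"
    define B' where "B' = {b \<in> B. b + e \<in> A}"
    have pA: "periodic_set k A'" and pB: "periodic_set k B'"
      using periodic_set_Un[OF less.prems(2) periodic_set_shift[OF less.prems(3), of "- e"]]
        periodic_set_Int[OF less.prems(3) periodic_set_shift[OF less.prems(2), of e]]
      by (simp_all add: A'_def B'_def Collect_conj_eq)
    have "b mod int k \<in> B \<inter> {0..<int k}" "b mod int k \<notin> B'"
    proof -
      have d: "int k dvd b - b mod int k" by (simp add: minus_mod_eq_mult_div)
      show "b mod int k \<in> B \<inter> {0..<int k}" using eb(2) periodic_setD[OF less.prems(3) d] less.prems(1) by simp
      show "b mod int k \<notin> B'" using periodic_setD[OF pB d] eb(3) by (auto simp: B'_def add.commute)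
    qed
    hence "B' \<inter> {0..<int k} \<subset> B \<inter> {0..<int k}" unfolding B'_def by blast
    hence lt: "card (B' \<inter> {0..<int k}) < card (B \<inter> {0..<int k})" by (intro psubset_card_mono) auto
    have sub: "x + y \<in> C" if "x \<in> A'" "y \<in> B'" for x y
    proof -
      have "(y + e) + (x - e) \<in> C" if "x - e \<in> B" using less.prems(6) that \<open>y \<in> B'\<close> unfolding B'_def by blast
      thus ?thesis using that less.prems(6) unfolding A'_def B'_def by (auto simp: algebra_simps)
    qed
    have "\<exists>D l. periodic_set k D \<and> D \<subseteq> C \<and> a \<in> D \<and> l \<ge> 1 \<and> periodic_set l D \<and> msr \<nu> A' + msr \<nu> B' \<le> msr \<nu> D + 1 / real l"
      by (rule less.hyps[OF lt less.prems(1) pA pB _ _ sub])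
        (use less.prems(4,5) eb in \<open>auto simp: A'_def B'_def\<close>)
    thus ?thesis using dyson_msr[OF \<nu>(1), of A e B] by (simp add: A'_def B'_def)
  qed
qed

text \<open>Every point of \<open>A + B\<close> lies in a subset that satisfies the inequality with
  some period of its own. These subsets are \<open>k\<close>-periodic, so finitely many cover
  \<open>A + B\<close>, and the union lemma merges them. The resulting period \<open>l\<close> of
  \<open>A + B\<close> is a multiple of \<open>k\<close>, hence \<open>1 / l\<close> is at most
  \<open>1 / k\<close>.\<close>

lemma kneser_periodic:
  fixes A B :: "int set"
  assumes k: "k \<ge> 1" and A: "periodic_set k A" "A \<noteq> {}" and B: "periodic_set k B" "B \<noteq> {}" and stab: "stab_gen k (A + B)"
  shows "msr \<nu> A + msr \<nu> B \<le> msr \<nu> (A + B) + 1 / real k"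
proof -
  define s where "s = msr \<nu> A + msr \<nu> B"
  define ok where "ok D \<longleftrightarrow> (\<exists>l\<ge>1. periodic_set l D \<and> s \<le> msr \<nu> D + 1 / real l)" for D
  have "\<exists>D. periodic_set k D \<and> D \<subseteq> A + B \<and> c \<in> D \<and> ok D" if "c \<in> A + B" for c
  proof -
    obtain a b where ab: "a \<in> A" "b \<in> B" "c = a + b" using \<open>c \<in> A + B\<close> unfolding set_plus_def by blast
    define B1 where "B1 = {x. x + b \<in> B}"
    define C1 where "C1 = {x. x + b \<in> A + B}"
    have "periodic_set k B1" using periodic_set_shift[OF B(1)] by (simp add: B1_def)
    moreover have "0 \<in> B1" using ab by (simp add: B1_def)
    moreover have "x + y \<in> C1" if "x \<in> A" "y \<in> B1" for x y
      using set_plus_intro[of x A "y + b" B] that unfolding B1_def C1_def by (simp add: add.assoc)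
    ultimately obtain D l where D: "periodic_set k D" "D \<subseteq> C1" "a \<in> D" "l \<ge> 1" "periodic_set l D"
        "msr \<nu> A + msr \<nu> B1 \<le> msr \<nu> D + 1 / real l"
      using dyson_periodic_class[OF k A(1) _ ab(1), of B1 C1] by blast
    define D' where "D' = {x. x + - b \<in> D}"
    have "periodic_set k D'" "periodic_set l D'" unfolding D'_def by (rule periodic_set_shift[OF D(1)], rule periodic_set_shift[OF D(5)])
    moreover have "D' \<subseteq> A + B" "c \<in> D'" using D(2,3) ab(3) unfolding D'_def C1_def by force+
    moreover have "msr \<nu> D' = msr \<nu> D" "msr \<nu> B1 = msr \<nu> B"
      unfolding D'_def B1_def by (rule msr_shift[OF \<nu>(1)])+
    ultimately have "periodic_set k D'" "D' \<subseteq> A + B" "c \<in> D'" "l \<ge> 1 \<and> periodic_set l D' \<and> s \<le> msr \<nu> D' + 1 / real l"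
      using D(4,6) by (simp_all add: s_def)
    thus ?thesis unfolding ok_def by blast
  qed
  then obtain D where D: "\<And>c. c \<in> A + B \<Longrightarrow> periodic_set k (D c) \<and> D c \<subseteq> A + B \<and> c \<in> D c \<and> ok (D c)"
    by metis
  have un: "ok (\<Union>c\<in>R. D c)" if "finite R" "R \<noteq> {}" "R \<subseteq> A + B" for R
    using that
  proof (induction R rule: finite_ne_induct)
    case (insert c R)
    hence "ok (D c)" "ok (\<Union>c\<in>R. D c)" using D by auto
    hence "ok (D c \<union> (\<Union>c\<in>R. D c))" unfolding ok_def by (metis periodic_set_union_step)
    thus ?case by simp
  qed (use D in auto)
  have perAB: "periodic_set k (A + B)"
    unfolding periodic_set_def
  proof (intro allI impI)
    fix x y assume xy: "int k dvd x - y" and "x \<in> A + B"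
    then obtain a b where ab: "a \<in> A" "b \<in> B" "x = a + b" unfolding set_plus_def by blast
    have "int k dvd a - (y - b)" using xy ab(3) by (simp add: algebra_simps)
    hence "y - b \<in> A" using periodic_setD[OF A(1)] ab(1) by blast
    from set_plus_intro[OF this ab(2)] show "y \<in> A + B" by simp
  qed
  define R where "R = (A + B) \<inter> {0..<int k}"
  have "A + B = (\<Union>r\<in>R. residue_class k r)" unfolding R_def by (rule periodic_set_eq_UN_residue_class[OF k perAB])
  moreover have "(\<Union>r\<in>R. residue_class k r) \<subseteq> (\<Union>r\<in>R. D r)"
  proof (rule UN_mono)
    fix r assume "r \<in> R"
    hence "periodic_set k (D r)" "r \<in> D r" using D unfolding R_def by auto
    thus "residue_class k r \<subseteq> D r" by (rule residue_class_subset)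
  qed simp
  moreover have "(\<Union>r\<in>R. D r) \<subseteq> A + B" using D unfolding R_def by blast
  ultimately have eq: "(\<Union>r\<in>R. D r) = A + B" by blast
  moreover have "A + B \<noteq> {}" using A(2) B(2) unfolding set_plus_def by blast
  ultimately have "R \<noteq> {}" by auto
  hence "ok (A + B)" using un[of R] eq unfolding R_def by simp
  then obtain l where l: "l \<ge> 1" "periodic_set l (A + B)" "s \<le> msr \<nu> (A + B) + 1 / real l"
    unfolding ok_def by blast
  have "\<forall>x. x \<in> A + B \<longleftrightarrow> x + int l \<in> A + B" by (intro allI periodic_setD[OF l(2)]) simp
  hence "int k dvd int l" using stab unfolding stab_gen_def by blast
  hence "k \<le> l" using l(1) by (intro dvd_imp_le) auto
  hence "1 / real l \<le> 1 / real k" using k by (intro divide_left_mono) auto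
  thus ?thesis using l(3) unfolding s_def by linarith
qed

end

section \<open>Splitting off the periodic part\<close>

definition avg :: "int set \<Rightarrow> (int \<Rightarrow> real) \<Rightarrow> real" where
  "avg G f = (\<Sum>x\<in>G. f x) / real (card G)"

lemma avg_indicator: "finite G \<Longrightarrow> avg G (indicator S) = real (card (S \<inter> G)) / real (card G)"
  unfolding avg_def by (simp add: indicator_def Int_commute Int_def)

lemma avg_add: "avg G (\<lambda>x. f x + g x) = avg G f + avg G g"
  by (simp add: avg_def sum.distrib add_divide_distrib)

lemma avg_cmult: "avg G (\<lambda>x. c * f x) = c * avg G f"
  by (simp add: avg_def sum_distrib_left)

lemma abs_avg_le:
  assumes "finite G" "\<And>x. \<bar>f x\<bar> \<le> M" "M \<ge> 0"
  shows "\<bar>avg G f\<bar> \<le> M"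
proof (cases "card G = 0")
  case False
  have "\<bar>\<Sum>x\<in>G. f x\<bar> \<le> (\<Sum>x\<in>G. \<bar>f x\<bar>)" by (rule sum_abs)
  also have "\<dots> \<le> (\<Sum>x\<in>G. M)" using assms(2) by (rule sum_mono)
  finally show ?thesis using False by (simp add: avg_def field_simps)
qed (use assms in \<open>simp add: avg_def\<close>)

definition folner_mean :: "(nat \<Rightarrow> int set) \<Rightarrow> (int \<Rightarrow> real) \<Rightarrow> real" where
  "folner_mean G f = glim (\<lambda>j. avg (G j) f)"

context
  fixes G assumes G: "folner_seq G"
begin

lemma finite_folner: "finite (G j)" and card_folner: "card (G j) > 0"
  using G by (auto simp: folner_seq_def card_gt_0_iff)

lemma bfun_avg:
  assumes "bfun f" shows "bfun (\<lambda>j. avg (G j) f)"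
proof -
  obtain M where M: "M \<ge> 0" "\<And>x. \<bar>f x\<bar> \<le> M" using assms bfunE by blast
  show ?thesis by (rule bfunI[of _ M]) (rule abs_avg_le[OF finite_folner M(2,1)])
qed

text \<open>A shift changes the sum only on the symmetric difference of the set and its translate,
  by at most the bound of \<open>f\<close> per point.\<close>

lemma avg_shift_tendsto:
  assumes "bfun f" shows "(\<lambda>j. avg (G j) (\<lambda>x. f (x + t)) - avg (G j) f) \<longlonglongrightarrow> 0"
proof -
  obtain M where M: "M \<ge> 0" "\<And>x. \<bar>f x\<bar> \<le> M" using assms bfunE by blast
  define q where "q j = real (card (sym_diff ((\<lambda>x. x + t) ` G j) (G j))) / real (card (G j))" for j
  have q: "q \<longlonglongrightarrow> 0" using G unfolding q_def folner_seq_def by blast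
  have "\<bar>avg (G j) (\<lambda>x. f (x + t)) - avg (G j) f\<bar> \<le> M * q j" for j
  proof -
    define H where "H = (\<lambda>x. x + t) ` G j"
    have fin: "finite H" "finite (G j)" unfolding H_def using finite_folner by auto
    have H: "(\<Sum>x\<in>G j. f (x + t)) = sum f H"
      unfolding H_def by (subst sum.reindex) (auto simp: inj_on_def)
    have "sum f H = sum f (H - G j) + sum f (H \<inter> G j)"
      using fin by (metis add.commute sum.Int_Diff)
    moreover have "sum f (G j) = sum f (G j - H) + sum f (H \<inter> G j)"
      using fin by (metis Int_commute add.commute sum.Int_Diff)
    ultimately have "\<bar>sum f H - sum f (G j)\<bar> \<le> \<bar>sum f (H - G j)\<bar> + \<bar>sum f (G j - H)\<bar>" by linarith
    also have "\<dots> \<le> (\<Sum>x\<in>H - G j. \<bar>f x\<bar>) + (\<Sum>x\<in>G j - H. \<bar>f x\<bar>)"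
      by (intro add_mono sum_abs)
    also have "\<dots> = (\<Sum>x\<in>sym_diff H (G j). \<bar>f x\<bar>)"
      using fin by (intro sum.union_disjoint[symmetric]) auto
    also have "\<dots> \<le> (\<Sum>x\<in>sym_diff H (G j). M)" using M(2) by (rule sum_mono)
    finally have "\<bar>sum f H - sum f (G j)\<bar> \<le> real (card (sym_diff H (G j))) * M" by simp
    hence "\<bar>sum f H - sum f (G j)\<bar> / real (card (G j)) \<le> real (card (sym_diff H (G j))) * M / real (card (G j))"
      by (rule divide_right_mono) simp
    moreover have "avg (G j) (\<lambda>x. f (x + t)) - avg (G j) f = (sum f H - sum f (G j)) / real (card (G j))"
      by (simp add: avg_def H diff_divide_distrib)
    ultimately show ?thesis by (simp add: q_def H_def mult.commute)
  qed
  moreover have "(\<lambda>j. M * q j) \<longlonglongrightarrow> 0" using tendsto_mult_left[OF q, of M] by simp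
  ultimately show ?thesis by - (rule Lim_null_comparison[of _ "\<lambda>j. M * q j"], auto)
qed

lemma imeas_folner_mean: "imeas (folner_mean G)"
proof (rule imeasI)
  fix f g :: "int \<Rightarrow> real" assume "bfun f" "bfun g"
  thus "folner_mean G (\<lambda>x. f x + g x) = folner_mean G f + folner_mean G g"
    unfolding folner_mean_def avg_add by (intro glim_add bfun_avg)
next
  fix f :: "int \<Rightarrow> real" and c assume "bfun f"
  thus "folner_mean G (\<lambda>x. c * f x) = c * folner_mean G f"
    unfolding folner_mean_def avg_cmult by (intro glim_cmult bfun_avg)
next
  fix f :: "int \<Rightarrow> real" assume f: "bfun f" "\<And>x. 0 \<le> f x"
  have "glim (\<lambda>j. 0) \<le> folner_mean G f"
    unfolding folner_mean_def using f bfun_avg[OF f(1)]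
    by (intro glim_mono[of _ _ 0]) (auto simp: avg_def sum_nonneg)
  thus "0 \<le> folner_mean G f" by simp
next
  fix f :: "int \<Rightarrow> real" and t assume f: "bfun f"
  have b: "bfun (\<lambda>j. avg (G j) (\<lambda>x. f (x + t)))" "bfun (\<lambda>j. avg (G j) f)"
    using f by (auto intro: bfun_avg bfun_shift)
  have "folner_mean G (\<lambda>x. f (x + t)) = glim (\<lambda>j. (avg (G j) (\<lambda>x. f (x + t)) - avg (G j) f) + avg (G j) f)"
    unfolding folner_mean_def by simp
  also have "\<dots> = 0 + folner_mean G f"
    unfolding folner_mean_def glim_tendsto[OF avg_shift_tendsto[OF f, of t], symmetric]
    using b by (intro glim_add) auto
  finally show "folner_mean G (\<lambda>x. f (x + t)) = folner_mean G f" by simp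
qed

lemma mass_folner_mean: "mass (folner_mean G) = 1"
proof -
  have "avg (G j) (\<lambda>x. 1) = 1" for j using card_folner[of j] by (simp add: avg_def)
  thus ?thesis by (simp add: folner_mean_def)
qed

end

text \<open>Union of all runs of \<open>L + 1\<close> consecutive integers that miss
  \<open>D\<close>. Restriction to the bare complement of \<open>D\<close> need not respect shifts,
  whereas a union of long runs has few ends and is almost invariant.\<close>

definition windows :: "int set \<Rightarrow> nat \<Rightarrow> int set" where
  "windows D L = {x. \<exists>y. y \<le> x \<and> x \<le> y + int L \<and> {y..y + int L} \<inter> D = {}}"

lemma windows_Int: "D \<inter> windows D L = {}"
  unfolding windows_def by auto

lemma windows_mono:
  assumes "L \<le> L'" shows "windows D L' \<subseteq> windows D L"
proof
  fix x assume "x \<in> windows D L'"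
  then obtain y where y: "y \<le> x" "x \<le> y + int L'" "{y..y + int L'} \<inter> D = {}"
    unfolding windows_def by blast
  define z where "z = min x (y + int L' - int L)"
  have z: "z \<le> x" "x \<le> z + int L" "{z..z + int L} \<subseteq> {y..y + int L'}"
    using y(1,2) assms by (auto simp: z_def)
  thus "x \<in> windows D L" unfolding windows_def using y(3) by blast
qed

text \<open>A point outside the windows has a point of \<open>D\<close> within distance
  \<open>L\<close> to its right. So a functional for which \<open>D\<close> is null has all its mass
  on the windows, for every \<open>L\<close>.\<close>

lemma compl_windows: "- windows D L \<subseteq> (\<Union>i\<in>{..L}. {x. x + int i \<in> D})"
proof
  fix x assume "x \<in> - windows D L"
  hence "{x..x + int L} \<inter> D \<noteq> {}" unfolding windows_def by force
  then obtain z where z: "z \<in> D" "x \<le> z" "z \<le> x + int L" by auto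
  hence "nat (z - x) \<in> {..L}" "x + int (nat (z - x)) \<in> D" by auto
  thus "x \<in> (\<Union>i\<in>{..L}. {x. x + int i \<in> D})" by blast
qed

context
  fixes \<nu> assumes \<nu>: "imeas \<nu>"
begin

text \<open>A right end of a run of windows is preceded by at least \<open>L\<close> points that are not right ends,
  so the translates of the set of right ends by \<open>0, \<dots>, L\<close> are disjoint.\<close>

lemma msr_windows_step:
  "msr \<nu> (sym_diff {x. x + 1 \<in> windows D L} (windows D L)) \<le> 2 * mass \<nu> / real (Suc L)"
proof -
  define U where "U = windows D L"
  define E where "E = U - {x. x + 1 \<in> U}"
  have run: "{x - int L..x} \<subseteq> U" if "x \<in> E" for x
  proof -
    obtain y where y: "y \<le> x" "x \<le> y + int L" "{y..y + int L} \<inter> D = {}"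
      using \<open>x \<in> E\<close> unfolding E_def U_def windows_def by blast
    have "x + 1 \<notin> U" using \<open>x \<in> E\<close> by (simp add: E_def)
    hence "\<not> x + 1 \<le> y + int L"
      using y(1,3) unfolding U_def windows_def by (auto dest!: spec[of _ y])
    hence "x = y + int L" using y(2) by simp
    thus ?thesis using y(3) unfolding U_def windows_def by auto
  qed
  have disj: "{x. x + int i \<in> E} \<inter> {x. x + int j \<in> E} = {}" if "i < j" "j \<le> L" for i j
  proof -
    have "False" if "x + int i \<in> E" "x + int j \<in> E" for x
    proof -
      have "x + int i + 1 \<in> U" using run[OF that(2)] \<open>i < j\<close> \<open>j \<le> L\<close> by auto
      thus False using that(1) by (simp add: E_def)
    qed
    thus ?thesis by blast
  qed
  have "msr \<nu> (\<Union>i\<in>{..L}. {x. x + int i \<in> E}) = (\<Sum>i\<in>{..L}. msr \<nu> {x. x + int i \<in> E})"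
  proof (rule msr_UN_disjoint[OF \<nu>])
    fix i j assume "i \<in> {..L}" "j \<in> {..L}" "i \<noteq> j"
    thus "{x. x + int i \<in> E} \<inter> {x. x + int j \<in> E} = {}"
      using disj[of i j] disj[of j i] by (cases i j rule: linorder_cases) auto
  qed simp
  also have "\<dots> = real (Suc L) * msr \<nu> E" by (simp add: msr_shift[OF \<nu>])
  finally have "real (Suc L) * msr \<nu> E \<le> mass \<nu>"
    using msr_le_mass[OF \<nu>, of "\<Union>i\<in>{..L}. {x. x + int i \<in> E}"] by simp
  hence E: "msr \<nu> E \<le> mass \<nu> / real (Suc L)" by (simp add: field_simps)
  \<comment> \<open>A set and its translate have equal measure, so left ends weigh as much as right
    ends.\<close>
  have "msr \<nu> ({x. x + 1 \<in> U} - U) = msr \<nu> E"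
    unfolding E_def by (simp add: msr_Diff[OF \<nu>] msr_shift[OF \<nu>] Int_commute)
  hence "msr \<nu> (sym_diff {x. x + 1 \<in> U} U) \<le> 2 * msr \<nu> E"
    using msr_Un_le[OF \<nu>, of "{x. x + 1 \<in> U} - U" "U - {x. x + 1 \<in> U}"] by (simp add: E_def)
  thus ?thesis using E by (simp add: U_def)
qed

lemma msr_windows_shift:
  "msr \<nu> (sym_diff {x. x + t \<in> windows D L} (windows D L)) \<le> 2 * real_of_int \<bar>t\<bar> * mass \<nu> / real (Suc L)"
proof -
  define U where "U = windows D L"
  define c where "c = 2 * mass \<nu> / real (Suc L)"
  have nat: "msr \<nu> (sym_diff {x. x + int n \<in> U} U) \<le> real n * c" for n
  proof (induction n)
    case 0
    have "sym_diff {x. x + int 0 \<in> U} U = {}" by auto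
    thus ?case using msr_empty[OF \<nu>] by (simp only: of_nat_0 mult_zero_left order_refl)
  next
    case (Suc n)
    have "sym_diff {x. x + int (Suc n) \<in> U} U
        \<subseteq> {x. x + int n \<in> sym_diff {x. x + 1 \<in> U} U} \<union> sym_diff {x. x + int n \<in> U} U"
      by (auto simp: algebra_simps)
    hence "msr \<nu> (sym_diff {x. x + int (Suc n) \<in> U} U) \<le> msr \<nu> {x. x + int n \<in> sym_diff {x. x + 1 \<in> U} U}
        + msr \<nu> (sym_diff {x. x + int n \<in> U} U)"
      by (intro order_trans[OF msr_mono[OF \<nu>] msr_Un_le[OF \<nu>]])
    also have "msr \<nu> {x. x + int n \<in> sym_diff {x. x + 1 \<in> U} U} = msr \<nu> (sym_diff {x. x + 1 \<in> U} U)"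
      by (rule msr_shift[OF \<nu>])
    also have "msr \<nu> (sym_diff {x. x + 1 \<in> U} U) \<le> c" unfolding U_def c_def by (rule msr_windows_step)
    finally show ?case using Suc by (simp add: distrib_right)
  qed
  have "msr \<nu> (sym_diff {x. x + t \<in> U} U) \<le> real_of_int \<bar>t\<bar> * c"
  proof (cases "t \<ge> 0")
    case True
    thus ?thesis using nat[of "nat t"] by simp
  next
    case False
    have "sym_diff {x. x + t \<in> U} U = {x. x + t \<in> sym_diff {x. x + int (nat (- t)) \<in> U} U}"
      using False by auto
    hence "msr \<nu> (sym_diff {x. x + t \<in> U} U) = msr \<nu> (sym_diff {x. x + int (nat (- t)) \<in> U} U)"
      by (simp only: msr_shift[OF \<nu>])
    thus ?thesis using nat[of "nat (- t)"] False by simp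
  qed
  thus ?thesis by (simp add: U_def c_def mult_ac)
qed

end

text \<open>Windows shrink as \<open>L\<close> grows, so for invariant \<open>\<nu>\<close> and
  nonnegative \<open>f\<close> the sequence decreases and \<open>glim\<close> is its ordinary limit;
  \<open>glim\<close> also gives linearity on all bounded functions at once.\<close>

definition window_part :: "((int \<Rightarrow> real) \<Rightarrow> real) \<Rightarrow> int set \<Rightarrow> (int \<Rightarrow> real) \<Rightarrow> real" where
  "window_part \<nu> D f = glim (\<lambda>L. \<nu> (\<lambda>x. f x * indicator (windows D L) x))"

context
  fixes \<nu> assumes \<nu>: "imeas \<nu>"
begin

lemma bfun_window:
  assumes "bfun f" shows "bfun (\<lambda>L. \<nu> (\<lambda>x. f x * indicator (windows D L) x))"
proof -
  obtain M where M: "M \<ge> 0" "\<And>x. \<bar>f x\<bar> \<le> M" using assms bfunE by blast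
  show ?thesis
    by (rule bfunI[of _ "M * mass \<nu>"], rule imeas_abs_le[OF \<nu>]) (use M in \<open>simp add: indicator_def\<close>)
qed

text \<open>For a single \<open>L\<close> the restriction need not be invariant. A shift by
  \<open>t\<close> changes it by at most a constant times \<open>\<bar>t\<bar> / (L + 1)\<close>,
  which vanishes in the limit.\<close>

lemma submeas_window_part: "submeas (window_part \<nu> D) \<nu>"
  unfolding submeas_def
proof (intro conjI allI impI imeasI)
  fix f g :: "int \<Rightarrow> real" assume "bfun f" "bfun g"
  thus "window_part \<nu> D (\<lambda>x. f x + g x) = window_part \<nu> D f + window_part \<nu> D g"
    unfolding window_part_def distrib_right by (simp add: imeas_add[OF \<nu>] glim_add bfun_window)
next
  fix f :: "int \<Rightarrow> real" and c assume "bfun f"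
  thus "window_part \<nu> D (\<lambda>x. c * f x) = c * window_part \<nu> D f"
    unfolding window_part_def mult.assoc by (simp add: imeas_cmult[OF \<nu>] glim_cmult bfun_window)
next
  fix f :: "int \<Rightarrow> real" assume f: "bfun f" "\<And>x. 0 \<le> f x"
  have "0 \<le> \<nu> (\<lambda>x. f x * indicator (windows D L) x)" for L
    using f by (intro imeas_nonneg[OF \<nu>]) auto
  hence "glim (\<lambda>L. 0) \<le> window_part \<nu> D f"
    unfolding window_part_def using f bfun_window by (intro glim_mono[of _ _ 0]) auto
  thus "0 \<le> window_part \<nu> D f" by simp
next
  fix f :: "int \<Rightarrow> real" assume f: "bfun f" "\<forall>x. 0 \<le> f x"
  have "\<nu> (\<lambda>x. f x * indicator (windows D L) x) \<le> \<nu> f" for L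
  proof (rule imeas_mono[OF \<nu>])
    show "f x * indicator (windows D L) x \<le> f x" for x using f(2) by (simp add: indicator_def)
  qed (use f in auto)
  hence "window_part \<nu> D f \<le> glim (\<lambda>L. \<nu> f)"
    unfolding window_part_def using f bfun_window by (intro glim_mono[of _ _ 0]) auto
  thus "window_part \<nu> D f \<le> \<nu> f" by simp
next
  fix f :: "int \<Rightarrow> real" and t assume f: "bfun f"
  obtain M where M: "M \<ge> 0" "\<And>x. \<bar>f x\<bar> \<le> M" using f bfunE by blast
  define a where "a L = \<nu> (\<lambda>x. f (x + t) * indicator (windows D L) x)" for L
  define b where "b L = \<nu> (\<lambda>x. f x * indicator (windows D L) x)" for L
  have ba: "bfun a" "bfun b" unfolding a_def b_def using f by (auto intro: bfun_window bfun_shift)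
  have "\<bar>a L - b L\<bar> \<le> (M * (2 * real_of_int \<bar>t\<bar> * mass \<nu>)) / real (Suc L)" for L
  proof -
    define U where "U = windows D L"
    define h where "h x = f (x + t) * (indicator U x - indicator U (x + t))" for x
    have bh: "bfun h" unfolding h_def using f by (intro bfun_mult bfun_diff bfun_shift) auto
    have "b L = \<nu> (\<lambda>x. f (x + t) * indicator U (x + t))"
      unfolding b_def U_def using f
      by (intro imeas_shift[OF \<nu>, symmetric, of "\<lambda>x. f x * indicator (windows D L) x"]) simp
    hence "a L - b L = \<nu> (\<lambda>x. f (x + t) * indicator U x - f (x + t) * indicator U (x + t))"
      unfolding a_def U_def using f by (subst imeas_diff[OF \<nu>]) (simp_all add: bfun_shift)
    hence ab: "a L - b L = \<nu> h" unfolding h_def by (simp add: right_diff_distrib)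
    have h: "\<bar>h x\<bar> \<le> M * indicator (sym_diff {x. x + t \<in> U} U) x" for x
      using M(2)[of "x + t"] M(1) by (auto simp: h_def indicator_def)
    have "\<nu> h \<le> \<nu> (\<lambda>x. M * indicator (sym_diff {x. x + t \<in> U} U) x)"
      by (rule imeas_mono[OF \<nu> bh]) (use h abs_le_D1 in auto)
    moreover have "\<nu> (\<lambda>x. - h x) \<le> \<nu> (\<lambda>x. M * indicator (sym_diff {x. x + t \<in> U} U) x)"
      by (rule imeas_mono[OF \<nu> bfun_minus[OF bh]]) (use h abs_le_D2 in auto)
    moreover have "\<nu> (\<lambda>x. - h x) = - \<nu> h" using imeas_cmult[OF \<nu> bh, of "-1"] by simp
    ultimately have "\<bar>\<nu> h\<bar> \<le> M * msr \<nu> (sym_diff {x. x + t \<in> U} U)"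
      by (simp add: imeas_cmult[OF \<nu>] abs_le_iff)
    also have "\<dots> \<le> M * (2 * real_of_int \<bar>t\<bar> * mass \<nu> / real (Suc L))"
      unfolding U_def using msr_windows_shift[OF \<nu>] M(1) by (rule mult_left_mono)
    finally show ?thesis using ab by simp
  qed
  moreover have "(\<lambda>L. c / real (Suc L)) \<longlonglongrightarrow> 0" for c
    using tendsto_mult_left[OF LIMSEQ_inverse_real_of_nat, of c] by (simp add: divide_inverse)
  ultimately have "(\<lambda>L. a L - b L) \<longlonglongrightarrow> 0"
    by - (rule Lim_null_comparison[of _ "\<lambda>L. (M * (2 * real_of_int \<bar>t\<bar> * mass \<nu>)) / real (Suc L)"],
      auto simp del: of_nat_Suc)
  hence "glim (\<lambda>L. a L - b L) = 0" by (rule glim_tendsto)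
  moreover have "glim (\<lambda>L. (a L - b L) + b L) = glim (\<lambda>L. a L - b L) + glim b"
    using ba by (intro glim_add) auto
  ultimately show "window_part \<nu> D (\<lambda>x. f (x + t)) = window_part \<nu> D f"
    unfolding window_part_def a_def[symmetric] b_def[symmetric] by simp
qed

end

lemma periodic_hull_plus: "periodic_hull k A + periodic_hull k B = periodic_hull k (A + B)"
proof -
  have "periodic_hull k A + periodic_hull k B = (A + B) + (multiples k + multiples k)"
    unfolding periodic_hull_eq[symmetric] by (simp add: ac_simps)
  also have "multiples k + multiples k = multiples k"
  proof (intro equalityI subsetI)
    fix x assume "x \<in> multiples k + multiples k"
    then obtain a b where "x = int k * a + int k * b" unfolding multiples_def set_plus_def by blast
    hence "x = int k * (a + b)" by (simp add: distrib_left)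
    thus "x \<in> multiples k" unfolding multiples_def by blast
  next
    fix x assume x: "x \<in> multiples k"
    have "0 \<in> multiples k" unfolding multiples_def by (rule range_eqI[of _ _ 0]) simp
    from set_plus_intro[OF x this] show "x \<in> multiples k + multiples k" by simp
  qed
  finally show ?thesis by (simp add: periodic_hull_eq)
qed

text \<open>What the windows miss carries no deficiency: otherwise \<open>ex_local_period\<close> finds a piece of it
  on which \<open>A + B\<close> is periodic, and such a piece lies in the windows.\<close>

lemma window_part_deficiency:
  fixes A B :: "int set"
  assumes \<nu>: "imeas \<nu>" and ne: "A \<noteq> {}" "B \<noteq> {}" and \<delta>: "\<delta> > 0"
    and def: "\<delta> \<le> msr \<nu> A + msr \<nu> B - msr \<nu> (A + B)"
  obtains k where "local_period (A + B) k"
    "\<delta> \<le> msr (window_part \<nu> (periodic_hull k (A + B) - (A + B))) A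
       + msr (window_part \<nu> (periodic_hull k (A + B) - (A + B))) B
       - msr (window_part \<nu> (periodic_hull k (A + B) - (A + B))) (A + B)"
    "real k * \<delta> \<le> mass (window_part \<nu> (periodic_hull k (A + B) - (A + B)))"
proof -
  define C where "C = A + B"
  obtain k where k: "local_period C k"
    using ex_local_period[OF \<nu>, of A B] def \<delta> unfolding C_def by (metis less_le_trans)
  define D where "D = periodic_hull k C - C"
  define \<omega> where "\<omega> = window_part \<nu> D"
  define \<rho> where "\<rho> f = \<nu> f - \<omega> f" for f
  have sub: "submeas \<omega> \<nu>" unfolding \<omega>_def by (rule submeas_window_part[OF \<nu>])
  have i\<omega>: "imeas \<omega>" using sub by (simp add: submeas_def)
  have i\<rho>: "imeas \<rho>" unfolding \<rho>_def by (rule imeas_diff_submeas[OF \<nu> sub])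
  define w where "w L = msr \<nu> (windows D L)" for L
  have bw: "bfun w" unfolding w_def using bfun_window[OF \<nu>, of "\<lambda>_. 1" D] by simp
  have \<omega>1: "mass \<omega> = glim w" unfolding \<omega>_def window_part_def w_def by simp
  have "msr \<rho> A + msr \<rho> B - msr \<rho> C \<le> 0"
  proof (rule ccontr)
    assume "\<not> ?thesis"
    then obtain \<mu> l where \<mu>: "local_period C l" "submeas \<mu> \<rho>" "mass \<mu> > 0" "msr \<mu> (periodic_hull l C - C) = 0"
      using ex_local_period[OF i\<rho>, of A B] unfolding C_def by (metis not_le)
    have "l = k" using local_period_unique[OF \<mu>(1) k] .
    hence \<mu>D: "msr \<mu> D = 0" using \<mu>(4) by (simp add: D_def)
    have i\<mu>: "imeas \<mu>" using \<mu>(2) by (simp add: submeas_def)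
    \<comment> \<open>\<open>\<mu>\<close> is null on \<open>D\<close>, so it lives on
      \<open>windows D L\<close> for every \<open>L\<close>, and so does \<open>\<omega>\<close>.
      Both fit under \<open>\<nu>\<close> there; but the measure of the windows tends to
      \<open>mass \<omega>\<close>, which leaves no room for \<open>\<mu>\<close>.\<close>
    have "mass \<mu> + mass \<omega> \<le> w L" for L
    proof -
      have "msr \<mu> (- windows D L) \<le> msr \<mu> (\<Union>i\<in>{..L}. {x. x + int i \<in> D})"
        by (rule msr_mono[OF i\<mu> compl_windows])
      also have "\<dots> \<le> (\<Sum>i\<in>{..L}. msr \<mu> {x. x + int i \<in> D})" by (rule msr_UN_le[OF i\<mu>]) simp
      also have "\<dots> = 0" by (simp add: msr_shift[OF i\<mu>] \<mu>D)
      finally have "mass \<mu> \<le> msr \<mu> (windows D L)"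
        using msr_Un_le[OF i\<mu>, of "windows D L" "- windows D L"] msr_UNIV[OF i\<mu>] by (simp add: Un_commute)
      also have "\<dots> \<le> \<rho> (indicator (windows D L))" using \<mu>(2) by (simp add: submeas_def)
      finally have 1: "mass \<mu> \<le> w L - msr \<omega> (windows D L)" by (simp add: \<rho>_def w_def)
      have "glim w = msr \<omega> (windows D L)"
        unfolding \<omega>_def window_part_def
      proof (rule glim_cong[where m = L])
        fix L' assume "L \<le> L'"
        hence "indicator (windows D L') = (\<lambda>x. indicator (windows D L) x * indicator (windows D L') x :: real)"
          using windows_mono[of L L' D] by (intro ext) (auto simp: indicator_def)
        thus "w L' = \<nu> (\<lambda>x. indicator (windows D L) x * indicator (windows D L') x)"
          unfolding w_def by (rule arg_cong)
      qed (use bw bfun_window[OF \<nu>] in auto)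
      thus ?thesis using 1 \<omega>1 by simp
    qed
    hence "glim (\<lambda>L. mass \<mu> + mass \<omega>) \<le> glim w"
      using bw by (intro glim_mono[of _ _ 0]) auto
    thus False using \<mu>(3) \<omega>1 by simp
  qed
  hence d\<omega>: "\<delta> \<le> msr \<omega> A + msr \<omega> B - msr \<omega> C" using def by (simp add: \<rho>_def C_def)
  hence "0 < msr \<omega> A + msr \<omega> B" using \<delta> msr_nonneg[OF i\<omega>, of C] by linarith
  hence p: "mass \<omega> > 0" using msr_le_mass[OF i\<omega>, of A] msr_le_mass[OF i\<omega>, of B] by linarith
  \<comment> \<open>Windows avoid \<open>D\<close>, so for \<open>\<omega>\<close> the sumset has
    the same measure as its hull, to which Kneser's bound applies.\<close>
  have "msr \<omega> D = 0"
  proof -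
    have "(\<lambda>x. indicator D x * indicator (windows D L) x :: real) = (\<lambda>x. 0)" for L
      using windows_Int[of D L] by (intro ext) (auto simp: indicator_def)
    thus ?thesis unfolding \<omega>_def window_part_def by (simp add: imeas_zero[OF \<nu>])
  qed
  moreover have "C \<inter> periodic_hull k C = C" using subset_periodic_hull[of C k] by blast
  ultimately have C: "msr \<omega> (periodic_hull k C) = msr \<omega> C"
    unfolding D_def by (simp add: msr_Diff[OF i\<omega>] Int_commute)
  define \<nu>' where "\<nu>' f = 1 / mass \<omega> * \<omega> f" for f
  have \<nu>': "imeas \<nu>'" "mass \<nu>' = 1"
    unfolding \<nu>'_def by (rule imeas_scale[OF i\<omega>]) (use p in auto)
  have k1: "k \<ge> 1" and st: "stab_gen k (periodic_hull k A + periodic_hull k B)"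
    using k unfolding local_period_def by (simp_all add: periodic_hull_plus C_def)
  have "msr \<nu>' (periodic_hull k A) + msr \<nu>' (periodic_hull k B) \<le> msr \<nu>' (periodic_hull k A + periodic_hull k B) + 1 / real k"
    using ne subset_periodic_hull[of A k] subset_periodic_hull[of B k]
    by (intro kneser_periodic[OF \<nu>' k1 periodic_set_periodic_hull _ periodic_set_periodic_hull _ st]) auto
  hence "(msr \<omega> (periodic_hull k A) + msr \<omega> (periodic_hull k B) - msr \<omega> (periodic_hull k C)) / mass \<omega> \<le> 1 / real k"
    by (simp add: \<nu>'_def periodic_hull_plus C_def diff_divide_distrib add_divide_distrib)
  hence "msr \<omega> (periodic_hull k A) + msr \<omega> (periodic_hull k B) - msr \<omega> (periodic_hull k C) \<le> mass \<omega> / real k"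
    using p by (simp add: pos_divide_le_eq)
  moreover have "msr \<omega> A \<le> msr \<omega> (periodic_hull k A)" "msr \<omega> B \<le> msr \<omega> (periodic_hull k B)"
    by (intro msr_mono[OF i\<omega>] subset_periodic_hull)+
  ultimately have "\<delta> \<le> mass \<omega> / real k" using d\<omega> C by linarith
  hence "real k * \<delta> \<le> mass \<omega>" using k1 by (simp add: field_simps)
  thus thesis using that k d\<omega> unfolding \<omega>_def D_def C_def by blast
qed

section \<open>Extraction of the Folner sequence\<close>

lemma folner_mean_approx:
  assumes G: "folner_seq G" and "finite \<S>" "e > 0"
  shows "\<exists>i\<ge>i0. \<forall>S\<in>\<S>. \<bar>real (card (S \<inter> G i)) / real (card (G i)) - msr (folner_mean G) S\<bar> < e"
proof -
  have "\<exists>i\<ge>i0. \<forall>f\<in>(\<lambda>S j. avg (G j) (indicator S)) ` \<S>. \<bar>f i - glim f\<bar> < e"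
    using assms bfun_avg[OF G] by (intro glim_approx) auto
  thus ?thesis by (simp add: folner_mean_def avg_indicator[OF finite_folner[OF G]])
qed

lemma window_part_approx:
  assumes \<nu>: "imeas \<nu>" and "finite \<S>" "e > 0"
  shows "\<exists>L\<ge>j. \<forall>S\<in>\<S>. \<bar>msr \<nu> (S \<inter> windows D L) - msr (window_part \<nu> D) S\<bar> < e"
proof -
  have "\<exists>L\<ge>j. \<forall>f\<in>(\<lambda>S L. \<nu> (\<lambda>x. indicator S x * indicator (windows D L) x)) ` \<S>. \<bar>f L - glim f\<bar> < e"
    using assms bfun_window[OF \<nu>] by (intro glim_approx) auto
  moreover have "(\<lambda>x. indicator S x * indicator (windows D L) x :: real) = indicator (S \<inter> windows D L)" for S L
    by (rule ext) (simp add: indicator_def)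
  ultimately show ?thesis by (simp add: window_part_def)
qed

text \<open>The subsequence realizes the lower limit for \<open>C\<close>, which is the term
  entering the deficiency with a minus sign; for all other sets a subsequence can only raise the
  lower limit. So the deficiency of the mean is at least \<open>\<delta>\<close>.\<close>

lemma ex_subsequence_lower_density:
  assumes F: "folner_seq F"
  obtains s where "strict_mono s" "folner_seq (F \<circ> s)"
    "msr (folner_mean (F \<circ> s)) C = lower_density F C"
    "\<And>A. lower_density F A \<le> msr (folner_mean (F \<circ> s)) A"
proof -
  obtain s :: "nat \<Rightarrow> nat" where s: "strict_mono s"
      "((\<lambda>n. ereal (rel_density F C n)) \<circ> s) \<longlonglongrightarrow> liminf (\<lambda>n. ereal (rel_density F C n))"
    using liminf_subseq_lim by blast
  have G: "folner_seq (F \<circ> s)"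
    using F LIMSEQ_subseq_LIMSEQ[OF _ s(1)] unfolding folner_seq_def by (fastforce simp: o_def)
  have avg: "avg ((F \<circ> s) j) (indicator S) = rel_density F S (s j)" for S j
    using avg_indicator[OF finite_folner[OF G]] by (simp add: rel_density_def)
  have "(\<lambda>j. ereal (rel_density F C (s j))) \<longlonglongrightarrow> ereal (lower_density F C)"
    using s(2) by (simp add: ereal_lower_density[OF F] o_def)
  hence "(\<lambda>j. rel_density F C (s j)) \<longlonglongrightarrow> lower_density F C" by simp
  hence "msr (folner_mean (F \<circ> s)) C = lower_density F C"
    unfolding folner_mean_def avg by (rule glim_tendsto)
  moreover have "lower_density F A \<le> msr (folner_mean (F \<circ> s)) A" for A
  proof (rule field_le_epsilon)
    fix e :: real assume "e > 0"
    hence "ereal (lower_density F A - e) < liminf (\<lambda>n. ereal (rel_density F A n))"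
      by (simp add: ereal_lower_density[OF F, symmetric])
    then obtain n0 where n0: "\<And>n. n \<ge> n0 \<Longrightarrow> lower_density F A - e < rel_density F A n"
      using less_LiminfD[of _ sequentially "\<lambda>n. ereal (rel_density F A n)"]
      by (fastforce simp: eventually_sequentially)
    have "glim (\<lambda>j. lower_density F A - e) \<le> msr (folner_mean (F \<circ> s)) A"
      unfolding folner_mean_def
    proof (rule glim_mono[where m = n0])
      fix j assume "n0 \<le> j"
      hence "n0 \<le> s j" using seq_suble[OF s(1), of j] by linarith
      thus "lower_density F A - e \<le> avg ((F \<circ> s) j) (indicator A)" unfolding avg using n0 by (simp add: less_imp_le)
    qed (use bfun_avg[OF G] in auto)
    thus "lower_density F A \<le> msr (folner_mean (F \<circ> s)) A + e" by simp
  qed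
  ultimately show thesis using that s(1) G by blast
qed

text \<open>Undoes two generalized limits. For each \<open>j\<close> a window length is chosen for
  which \<open>\<nu>\<close> on the windows is close to \<open>\<omega>\<close>, then an index for
  which counting in \<open>G i\<close> is close to \<open>\<nu>\<close>. The boundary sets
  \<open>W L t\<close> are among the sets tested, because the almost invariance of windows has to be
  transferred from \<open>\<nu>\<close> to finite sets.\<close>

lemma ex_window_sets:
  assumes G: "folner_seq G" and fin: "finite \<S>" and p: "0 < mass (window_part (folner_mean G) D)"
  obtains i \<Psi> where "strict_mono i" "\<And>j. \<Psi> j \<subseteq> G (i j)" "\<And>j. \<Psi> j \<inter> D = {}" "folner_seq \<Psi>"
    "(\<lambda>j. real (card (\<Psi> j)) / real (card (G (i j)))) \<longlonglongrightarrow> mass (window_part (folner_mean G) D)"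
    "\<And>S. S \<in> \<S> \<Longrightarrow> rel_density \<Psi> S
       \<longlonglongrightarrow> msr (window_part (folner_mean G) D) S / mass (window_part (folner_mean G) D)"
proof -
  define \<nu> where "\<nu> = folner_mean G"
  define \<omega> where "\<omega> = window_part \<nu> D"
  define p where "p = mass \<omega>"
  have \<nu>: "imeas \<nu>" "mass \<nu> = 1"
    unfolding \<nu>_def by (rule imeas_folner_mean[OF G], rule mass_folner_mean[OF G])
  have p0: "p > 0" using p by (simp add: p_def \<omega>_def \<nu>_def)
  have pU: "msr \<omega> UNIV = p" by (simp add: p_def indicator_def)
  \<comment> \<open>An error of \<open>2 * e j\<close> is at most \<open>p / 2\<close>, so it cannot
    make \<open>\<Psi> j\<close> empty.\<close>
  define e where "e j = p / (4 * real (Suc j))" for j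
  have e0: "e j > 0" for j using p0 by (simp add: e_def)
  have e_small: "e j \<le> p / 4" for j
    unfolding e_def using p0 by (intro divide_left_mono) auto
  have e_lim: "e \<longlonglongrightarrow> 0"
  proof -
    have "e = (\<lambda>j. p / 4 * inverse (real (Suc j)))"
      by (rule ext) (simp add: e_def field_simps del: of_nat_Suc)
    thus ?thesis using tendsto_mult_left[OF LIMSEQ_inverse_real_of_nat, of "p / 4"] by simp
  qed
  define \<S>' where "\<S>' = insert UNIV \<S>"
  define W where "W L t = sym_diff {x. x + t \<in> windows D L} (windows D L)" for L t
  define P where "P j i L \<longleftrightarrow> L \<ge> j \<and>
      (\<forall>S\<in>\<S>'. \<bar>real (card (S \<inter> windows D L \<inter> G i)) / real (card (G i)) - msr \<omega> S\<bar> \<le> 2 * e j) \<and>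
      (\<forall>t. \<bar>t\<bar> \<le> int j \<longrightarrow>
         real (card (W L t \<inter> G i)) / real (card (G i)) \<le> 2 * real_of_int \<bar>t\<bar> / real (Suc L) + e j)"
    for j i L
  have ex: "\<exists>i\<ge>i0. \<exists>L. P j i L" for j i0
  proof -
    obtain L where L: "L \<ge> j" "\<forall>S\<in>\<S>'. \<bar>msr \<nu> (S \<inter> windows D L) - msr \<omega> S\<bar> < e j"
      unfolding \<omega>_def using window_part_approx[OF \<nu>(1) _ e0, of \<S>' j D j] fin
      unfolding \<S>'_def by blast
    define \<T> where "\<T> = (\<lambda>S. S \<inter> windows D L) ` \<S>' \<union> W L ` {- int j..int j}"
    have "finite \<T>" using fin by (simp add: \<T>_def \<S>'_def)
    then obtain i where i: "i \<ge> i0"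
        "\<forall>S\<in>\<T>. \<bar>real (card (S \<inter> G i)) / real (card (G i)) - msr \<nu> S\<bar> < e j"
      unfolding \<nu>_def using folner_mean_approx[OF G _ e0] by blast
    have "\<bar>real (card (S \<inter> windows D L \<inter> G i)) / real (card (G i)) - msr \<omega> S\<bar> \<le> 2 * e j" if "S \<in> \<S>'" for S
    proof -
      have "S \<inter> windows D L \<in> \<T>" using that by (simp add: \<T>_def)
      thus ?thesis using L(2) i(2) that by fastforce
    qed
    moreover have "real (card (W L t \<inter> G i)) / real (card (G i)) \<le> 2 * real_of_int \<bar>t\<bar> / real (Suc L) + e j"
      if "\<bar>t\<bar> \<le> int j" for t
    proof -
      have "t \<in> {- int j..int j}" using that by auto
      hence "W L t \<in> \<T>" unfolding \<T>_def by blast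
      thus ?thesis
        using i(2) msr_windows_shift[OF \<nu>(1), of t D L] \<nu>(2) unfolding W_def by fastforce
    qed
    ultimately have "P j i L" unfolding P_def using L(1) by blast
    thus ?thesis using i(1) by blast
  qed
  have "\<exists>i. \<forall>j. (\<exists>L. P j (i j) L) \<and> i j < i (Suc j)"
  proof (rule dependent_nat_choice)
    show "\<exists>i. \<exists>L. P 0 i L" using ex by blast
    show "\<exists>i'. (\<exists>L. P (Suc j) i' L) \<and> i < i'" for i j using ex[of "Suc i" "Suc j"] by (auto simp: Suc_le_eq)
  qed
  then obtain i where i: "\<And>j. \<exists>L. P j (i j) L" "\<And>j. i j < i (Suc j)" by blast
  then obtain L where L: "\<And>j. P j (i j) (L j)" by metis
  have mono: "strict_mono i" using i(2) by (simp add: strict_mono_Suc_iff)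
  define U where "U j = windows D (L j)" for j
  define \<Psi> where "\<Psi> j = U j \<inter> G (i j)" for j
  define N where "N j = real (card (G (i j)))" for j
  have N: "N j > 0" for j using card_folner[OF G] by (simp add: N_def)
  have fin\<Psi>: "finite (\<Psi> j)" for j using finite_folner[OF G] by (simp add: \<Psi>_def)
  have approx: "\<bar>real (card (S \<inter> \<Psi> j)) / N j - msr \<omega> S\<bar> \<le> 2 * e j" if "S \<in> \<S>'" for S j
    using L[of j] that unfolding P_def \<Psi>_def U_def N_def by (simp add: Int_assoc)
  have lim: "(\<lambda>j. real (card (S \<inter> \<Psi> j)) / N j) \<longlonglongrightarrow> msr \<omega> S" if "S \<in> \<S>'" for S
  proof (rule LIM_zero_cancel, rule Lim_null_comparison[of _ "\<lambda>j. 2 * e j"])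
    show "(\<lambda>j. 2 * e j) \<longlonglongrightarrow> 0" using tendsto_mult_left[OF e_lim, of 2] by simp
  qed (use approx[OF that] in auto)
  have U: "UNIV \<in> \<S>'" by (simp add: \<S>'_def)
  have \<Psi>pos: "card (\<Psi> j) > 0" for j
  proof -
    have "\<bar>real (card (\<Psi> j)) / N j - p\<bar> \<le> 2 * e j" using approx[OF U, of j] pU by simp
    hence "real (card (\<Psi> j)) / N j > 0" using e_small[of j] p0 by linarith
    thus ?thesis by (cases "card (\<Psi> j) = 0") auto
  qed
  have lim\<Psi>: "(\<lambda>j. real (card (\<Psi> j)) / N j) \<longlonglongrightarrow> p" using lim[OF U] pU by simp
  have dens: "rel_density \<Psi> S \<longlonglongrightarrow> msr \<omega> S / p" if "S \<in> \<S>" for S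
  proof -
    have "(\<lambda>j. (real (card (S \<inter> \<Psi> j)) / N j) / (real (card (\<Psi> j)) / N j)) \<longlonglongrightarrow> msr \<omega> S / p"
      using lim[of S] that lim\<Psi> p0 by (intro tendsto_divide) (auto simp: \<S>'_def)
    moreover have "(real (card (S \<inter> \<Psi> j)) / N j) / (real (card (\<Psi> j)) / N j) = rel_density \<Psi> S j" for j
      using N[of j] \<Psi>pos[of j] by (simp add: rel_density_def)
    ultimately show ?thesis by simp
  qed
  have "folner_seq \<Psi>"
    unfolding folner_seq_def
  proof (intro conjI allI)
    show "finite (\<Psi> j)" "\<Psi> j \<noteq> {}" for j using fin\<Psi> \<Psi>pos[of j] by auto
  next
    fix t :: int
    define q where "q j = real (card (sym_diff ((\<lambda>x. x + t) ` G j) (G j))) / real (card (G j))" for j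
    define r where "r j = real (card (sym_diff ((\<lambda>x. x + t) ` \<Psi> j) (\<Psi> j)))" for j
    have q: "(q \<circ> i) \<longlonglongrightarrow> 0"
      using G unfolding q_def folner_seq_def by (intro LIMSEQ_subseq_LIMSEQ[OF _ mono]) blast
    have bound: "r j / N j \<le> (q \<circ> i) j + (2 * real_of_int \<bar>t\<bar> / real (Suc j) + e j)" if j: "j \<ge> nat \<bar>t\<bar>" for j
    proof -
      define H where "H = sym_diff ((\<lambda>x. x + t) ` G (i j)) (G (i j))"
      \<comment> \<open>If the shift does not alter membership of \<open>x\<close> in
        \<open>G (i j)\<close>, it can alter membership in \<open>\<Psi> j\<close> only for
        \<open>x\<close> in \<open>G (i j)\<close> at a boundary of the windows. The sign of
        \<open>t\<close> changes because the image under adding \<open>t\<close> is a preimage under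
        subtracting it.\<close>
      define V where "V = W (L j) (- t) \<inter> G (i j)"
      have "finite H" "finite V" unfolding H_def V_def using finite_folner[OF G] by auto
      have "sym_diff ((\<lambda>x. x + t) ` \<Psi> j) (\<Psi> j) \<subseteq> H \<union> V"
      proof
        fix x assume x: "x \<in> sym_diff ((\<lambda>x. x + t) ` \<Psi> j) (\<Psi> j)"
        have im: "x \<in> (\<lambda>x. x + t) ` X \<longleftrightarrow> x + - t \<in> X" for X by force
        show "x \<in> H \<union> V"
        proof (rule ccontr)
          assume "x \<notin> H \<union> V"
          hence H: "x + - t \<in> G (i j) \<longleftrightarrow> x \<in> G (i j)"
            and V: "x \<in> G (i j) \<Longrightarrow> x + - t \<in> U j \<longleftrightarrow> x \<in> U j"
            unfolding H_def V_def W_def U_def using im[of "G (i j)"] by blast+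
          have "x + - t \<in> \<Psi> j \<longleftrightarrow> x \<in> \<Psi> j" unfolding \<Psi>_def using H V by blast
          thus False using x im[of "\<Psi> j"] by blast
        qed
      qed
      hence "card (sym_diff ((\<lambda>x. x + t) ` \<Psi> j) (\<Psi> j)) \<le> card (H \<union> V)"
        using \<open>finite H\<close> \<open>finite V\<close> by (intro card_mono) blast+
      also have "\<dots> \<le> card H + card V" by (rule card_Un_le)
      finally have "card (sym_diff ((\<lambda>x. x + t) ` \<Psi> j) (\<Psi> j)) \<le> card H + card V" .
      hence "r j \<le> real (card H) + real (card V)" by (simp add: r_def)
      hence "r j / N j \<le> (real (card H) + real (card V)) / N j" using N[of j] by (intro divide_right_mono) auto
      also have "\<dots> = (q \<circ> i) j + real (card V) / N j" by (simp add: add_divide_distrib q_def H_def N_def)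
      also have "real (card V) / N j \<le> 2 * real_of_int \<bar>- t\<bar> / real (Suc (L j)) + e j"
      proof -
        have "\<bar>- t\<bar> \<le> int j" using j by linarith
        thus ?thesis using L[of j] unfolding P_def V_def N_def by blast
      qed
      also have "2 * real_of_int \<bar>- t\<bar> / real (Suc (L j)) \<le> 2 * real_of_int \<bar>t\<bar> / real (Suc j)"
        using L[of j] unfolding P_def by (simp only: abs_minus_cancel) (intro divide_left_mono, auto)
      finally show ?thesis by simp
    qed
    have "(\<lambda>j. (q \<circ> i) j + (2 * real_of_int \<bar>t\<bar> / real (Suc j) + e j)) \<longlonglongrightarrow> 0 + (0 + 0)"
      using tendsto_mult_left[OF LIMSEQ_inverse_real_of_nat, of "2 * real_of_int \<bar>t\<bar>"]
      by (intro tendsto_add q e_lim) (simp add: divide_inverse)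
    hence "(\<lambda>j. r j / N j) \<longlonglongrightarrow> 0"
    proof (intro Lim_null_comparison[of "\<lambda>j. r j / N j" "\<lambda>j. (q \<circ> i) j + (2 * real_of_int \<bar>t\<bar> / real (Suc j) + e j)"])
      show "\<forall>\<^sub>F j in sequentially. norm (r j / N j) \<le> (q \<circ> i) j + (2 * real_of_int \<bar>t\<bar> / real (Suc j) + e j)"
        using eventually_ge_at_top[of "nat \<bar>t\<bar>"]
      proof eventually_elim
        case (elim j)
        have "r j / N j \<ge> 0" using N[of j] by (simp add: r_def)
        thus ?case using bound[OF elim] by simp
      qed
    qed simp
    hence "(\<lambda>j. (r j / N j) / (real (card (\<Psi> j)) / N j)) \<longlonglongrightarrow> 0 / p"
      using lim\<Psi> p0 by (intro tendsto_divide) auto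
    moreover have "(r j / N j) / (real (card (\<Psi> j)) / N j) = r j / real (card (\<Psi> j))" for j
      using N[of j] by simp
    ultimately have "(\<lambda>j. r j / real (card (\<Psi> j))) \<longlonglongrightarrow> 0" by (simp only: div_0)
    thus "(\<lambda>j. real (card (sym_diff ((\<lambda>x. x + t) ` \<Psi> j) (\<Psi> j))) / real (card (\<Psi> j))) \<longlonglongrightarrow> 0"
      by (simp add: r_def)
  qed
  moreover have "\<Psi> j \<subseteq> G (i j)" "\<Psi> j \<inter> D = {}" for j
    unfolding \<Psi>_def U_def using windows_Int[of D] by auto
  ultimately show thesis
    using that mono lim\<Psi> dens unfolding N_def p_def \<omega>_def \<nu>_def by blast
qed

lemma local_period_folner_subsequence:
  fixes A B :: "int set"
  assumes ne: "A \<noteq> {}" "B \<noteq> {}" and F: "folner_seq F"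
    and \<delta>_def: "\<delta> = lower_density F A + lower_density F B - lower_density F (A + B)" and \<delta>: "\<delta> > 0"
  shows "\<exists>k. local_period (A + B) k \<and> (\<exists>(n :: nat \<Rightarrow> nat) (\<Psi> :: nat \<Rightarrow> int set).
      strict_mono n \<and> (\<forall>j. \<Psi> j \<subseteq> F (n j)) \<and> folner_seq \<Psi> \<and>
      liminf (\<lambda>j. ereal (real (card (\<Psi> j)) / real (card (F (n j))))) \<ge> ereal (real k * \<delta>) \<and>
      has_density \<Psi> (A + B) \<and> has_density \<Psi> (A + B + multiples k) \<and>
      folner_density \<Psi> (A + B) = folner_density \<Psi> (A + B + multiples k) \<and>
      has_density \<Psi> A \<and> has_density \<Psi> B \<and>
      folner_density \<Psi> A + folner_density \<Psi> B - folner_density \<Psi> (A + B) \<ge> \<delta>)"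
proof -
  define C where "C = A + B"
  obtain s where s: "strict_mono s" "folner_seq (F \<circ> s)"
      "msr (folner_mean (F \<circ> s)) C = lower_density F C"
      "\<And>A. lower_density F A \<le> msr (folner_mean (F \<circ> s)) A"
    by (rule ex_subsequence_lower_density[OF F, of C]) blast
  define \<nu> where "\<nu> = folner_mean (F \<circ> s)"
  have \<nu>: "imeas \<nu>" "mass \<nu> = 1"
    unfolding \<nu>_def by (rule imeas_folner_mean[OF s(2)], rule mass_folner_mean[OF s(2)])
  have "\<delta> \<le> msr \<nu> A + msr \<nu> B - msr \<nu> (A + B)"
    using s(3) s(4)[of A] s(4)[of B] unfolding \<delta>_def \<nu>_def C_def by linarith
  then obtain k where k: "local_period C k"
      "\<delta> \<le> msr (window_part \<nu> (periodic_hull k C - C)) A + msr (window_part \<nu> (periodic_hull k C - C)) B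
         - msr (window_part \<nu> (periodic_hull k C - C)) C"
      "real k * \<delta> \<le> mass (window_part \<nu> (periodic_hull k C - C))"
    using window_part_deficiency[OF \<nu>(1) ne \<delta>] unfolding C_def by metis
  define D where "D = periodic_hull k C - C"
  define \<omega> where "\<omega> = window_part \<nu> D"
  have \<omega>1: "mass \<omega> \<le> 1"
  proof -
    have "bfun (\<lambda>x::int. 1)" "\<forall>x::int. (0::real) \<le> 1" by auto
    hence "mass \<omega> \<le> mass \<nu>"
      using submeas_window_part[OF \<nu>(1), of D] unfolding submeas_def \<omega>_def by blast
    thus ?thesis using \<nu>(2) by simp
  qed
  have "real k * \<delta> > 0" using k(1) \<delta> by (simp add: local_period_def)
  hence p: "mass \<omega> > 0" using k(3) by (simp add: \<omega>_def D_def)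
  obtain i \<Psi> where \<Psi>: "strict_mono i" "\<And>j. \<Psi> j \<subseteq> (F \<circ> s) (i j)" "\<And>j. \<Psi> j \<inter> D = {}" "folner_seq \<Psi>"
      "(\<lambda>j. real (card (\<Psi> j)) / real (card ((F \<circ> s) (i j)))) \<longlonglongrightarrow> mass \<omega>"
      "\<And>S. S \<in> {A, B, C} \<Longrightarrow> rel_density \<Psi> S \<longlonglongrightarrow> msr \<omega> S / mass \<omega>"
    using ex_window_sets[OF s(2), of "{A, B, C}" D] p unfolding \<omega>_def \<nu>_def by blast
  have dens: "has_density \<Psi> S" "folner_density \<Psi> S = msr \<omega> S / mass \<omega>" if "S \<in> {A, B, C}" for S
    using \<Psi>(6)[OF that] unfolding has_density_def folner_density_def
    by (auto intro: convergentI limI)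
  \<comment> \<open>The sets \<open>\<Psi> j\<close> avoid \<open>D\<close>, so the two relative
    densities agree term by term and not just in the limit.\<close>
  have "periodic_hull k C \<inter> \<Psi> j = C \<inter> \<Psi> j" for j
    using \<Psi>(3)[of j] subset_periodic_hull[of C k] unfolding D_def by blast
  hence eq: "rel_density \<Psi> (C + multiples k) = rel_density \<Psi> C"
    by (simp add: periodic_hull_eq rel_density_def fun_eq_iff)
  have "(\<lambda>j. ereal (real (card (\<Psi> j)) / real (card (F ((s \<circ> i) j))))) \<longlonglongrightarrow> ereal (mass \<omega>)"
    using \<Psi>(5) by simp
  hence "liminf (\<lambda>j. ereal (real (card (\<Psi> j)) / real (card (F ((s \<circ> i) j))))) = ereal (mass \<omega>)"
    by (rule lim_imp_Liminf[OF sequentially_bot])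
  hence 1: "liminf (\<lambda>j. ereal (real (card (\<Psi> j)) / real (card (F ((s \<circ> i) j))))) \<ge> ereal (real k * \<delta>)"
    using k(3) by (simp add: \<omega>_def D_def)
  \<comment> \<open>Dividing a deficiency of at least \<open>\<delta>\<close> by a mass of at most 1
    keeps it at least \<open>\<delta>\<close>.\<close>
  have "\<delta> * mass \<omega> \<le> msr \<omega> A + msr \<omega> B - msr \<omega> C"
  proof -
    have "\<delta> * mass \<omega> \<le> \<delta> * 1" using \<omega>1 \<delta> by (intro mult_left_mono) auto
    thus ?thesis using k(2) by (simp add: \<omega>_def D_def)
  qed
  hence 2: "folner_density \<Psi> A + folner_density \<Psi> B - folner_density \<Psi> C \<ge> \<delta>"
    using p by (simp add: dens add_divide_distrib[symmetric] diff_divide_distrib[symmetric] pos_le_divide_eq)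
  show ?thesis
    unfolding C_def[symmetric]
  proof (intro exI[of _ k] exI[of _ "s \<circ> i"] exI[of _ \<Psi>] conjI)
    show "strict_mono (s \<circ> i)" using s(1) \<Psi>(1) by (rule strict_mono_o)
    show "\<forall>j. \<Psi> j \<subseteq> F ((s \<circ> i) j)" using \<Psi>(2) by simp
    show "has_density \<Psi> (C + multiples k)" "folner_density \<Psi> C = folner_density \<Psi> (C + multiples k)"
      using dens(1)[of C] by (simp_all add: has_density_def folner_density_def eq)
  qed (use k(1) 1 2 \<Psi>(4) dens(1) in auto)
qed

theorem theorem1p6:
  "\<exists>K :: int set \<Rightarrow> nat. \<forall>A B :: int set. A \<noteq> {} \<longrightarrow> B \<noteq> {} \<longrightarrow>
     (let k = K (A + B) in
        k \<ge> 1 \<and>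
        (\<forall>F. folner_seq F \<longrightarrow>
          (let \<delta> = lower_density F A + lower_density F B - lower_density F (A + B) in
             \<delta> > 0 \<longrightarrow>
             (\<exists>(n :: nat \<Rightarrow> nat) (\<Psi> :: nat \<Rightarrow> int set).
                strict_mono n \<and>
                (\<forall>j. \<Psi> j \<subseteq> F (n j)) \<and>
                folner_seq \<Psi> \<and>
                liminf (\<lambda>j. ereal (real (card (\<Psi> j)) / real (card (F (n j)))))
                  \<ge> ereal (real k * \<delta>) \<and>
                has_density \<Psi> (A + B) \<and>
                has_density \<Psi> (A + B + multiples k) \<and>
                folner_density \<Psi> (A + B) = folner_density \<Psi> (A + B + multiples k) \<and>
                has_density \<Psi> A \<and>
                has_density \<Psi> B \<and>
                folner_density \<Psi> A + folner_density \<Psi> B - folner_density \<Psi> (A + B) \<ge> \<delta>))))"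
proof -
  \<comment> \<open>If \<open>C\<close> has no local period, no Folner sequence yields a positive
    \<open>\<delta>\<close> and the default 1 is harmless; otherwise uniqueness makes the choice
    independent of the Folner sequence.\<close>
  define K where "K C = (if \<exists>k. local_period C k then SOME k. local_period C k else 1)" for C
  have K: "K C = k" if "local_period C k" for C k
  proof -
    have "local_period C (K C)" unfolding K_def using that someI_ex[of "local_period C"] by auto
    thus ?thesis using that by (rule local_period_unique)
  qed
  have K1: "K C \<ge> 1" for C
    using K[of C] by (cases "\<exists>k. local_period C k") (auto simp: K_def[of C] local_period_def)
  show ?thesis
    unfolding Let_def
  proof (intro exI[of _ K] allI impI conjI)
    fix A B :: "int set" and F
    assume ne: "A \<noteq> {}" "B \<noteq> {}"
    show "K (A + B) \<ge> 1" by (rule K1)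
    assume F: "folner_seq F" "lower_density F A + lower_density F B - lower_density F (A + B) > 0"
    from local_period_folner_subsequence[OF ne F(1) refl F(2)] show "\<exists>(n :: nat \<Rightarrow> nat) (\<Psi> :: nat \<Rightarrow> int set).
        strict_mono n \<and> (\<forall>j. \<Psi> j \<subseteq> F (n j)) \<and> folner_seq \<Psi> \<and>
        liminf (\<lambda>j. ereal (real (card (\<Psi> j)) / real (card (F (n j)))))
          \<ge> ereal (real (K (A + B)) * (lower_density F A + lower_density F B - lower_density F (A + B))) \<and>
        has_density \<Psi> (A + B) \<and> has_density \<Psi> (A + B + multiples (K (A + B))) \<and>
        folner_density \<Psi> (A + B) = folner_density \<Psi> (A + B + multiples (K (A + B))) \<and>
        has_density \<Psi> A \<and> has_density \<Psi> B \<and>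
        folner_density \<Psi> A + folner_density \<Psi> B - folner_density \<Psi> (A + B)
          \<ge> lower_density F A + lower_density F B - lower_density F (A + B)"
    proof (elim exE, goal_cases)
      case (1 k)
      hence "K (A + B) = k" using K by blast
      thus ?case using 1 by (simp only:)
    qed
  qed
qed

end
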